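(* Let $T>0$ and let $\lambda,G,g,\rho_0,F,f$ be as in the context. The pair $(\rho,z)$ of functions on $[0,T]$, with $0\le\rho_t\le 1$, satisfying $$\rho_t=\rho_0\bar F(t)+\int_0^t z(u)\lambda(u)\bar G(t-u)\,du,\qquad t\in[0,T],$$ $$z(t)\lambda(t)=\begin{cases}\lambda(t), & \rho_t<1,\\ \rho_0f(t)+\int_0^t z(u)\lambda(u)g(t-u)\,du, & \rho_t=1,\end{cases}\qquad\text{for a.e. }t\in[0,T],$$ and $$\mathbb 1_{\{\rho_t<1\}}\le z(t)\le1\quad\text{for a.e. }t\in[0,T],$$ is a solution of the discontinuous Volterra integral equation $\rho_t=\rho_0\bar F(t)+\int_0^t\mathbb 1_{\{\rho_{u-}<1\}}\bar G(t-u)\lambda(u)\,du$, in the sense that $\rho_t=\rho_0\bar F(t)+\int_0^t z(u)\bar G(t-u)\lambda(u)\,du$ and $0\le\rho_t\le1$ for all $t\in[0,T]$, and $\mathbb 1_{\{\rho_t<1\}}\le z(t)\le1$ a.e. in $[0,T]$. In addition, the function $z\lambda$ is unique almost everywhere on $[0,T]$.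
   Context: $\lambda:[0,\infty)\to[0,\infty)$ is locally integrable; $G$ is a probability distribution function on $[0,\infty)$ with density $g$, $\bar G=1-G$; $\rho_0\in[0,1]$; $F$ is a probability distribution function on $[0,\infty)$ with density $f$, $\bar F=1-F$. (These are the data of a sequence of $M_t/G/n/n$ loss queues with arrival intensity $n\lambda$, service distribution $G$, limiting initial fraction of busy servers $\rho_0$ and limiting remaining-service distribution $F$ of initially busy servers.) There is a unique function $\rho$ for which some $z$ exists such that $(\rho,z)$ is a solution of the Volterra equation in the sense stated in the claim. *)

theory Defs
  imports "HOL-Probability.Probability"
begin

text \<open>Functions on \<open>[0, \<infinity>)\<close> or \<open>[0, T]\<close> are total functions \<open>real \<Rightarrow> real\<close>
  whose values outside these intervals are never used.\<close>

definition loc_integrable_halfline :: "(real \<Rightarrow> real) \<Rightarrow> bool" where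
  "loc_integrable_halfline \<phi> \<longleftrightarrow> (\<forall>t\<ge>0. set_integrable lebesgue {0..t} \<phi>)"

definition distribution_function_halfline :: "(real \<Rightarrow> real) \<Rightarrow> bool" where
  "distribution_function_halfline G \<longleftrightarrow>
     (\<exists>M. real_distribution M \<and> measure M {0..} = 1 \<and> (\<forall>t\<ge>0. G t = cdf M t))"

definition has_density_halfline :: "(real \<Rightarrow> real) \<Rightarrow> (real \<Rightarrow> real) \<Rightarrow> bool" where
  "has_density_halfline G g \<longleftrightarrow>
     (\<forall>t\<ge>0. 0 \<le> g t) \<and> set_integrable lebesgue {0..} g \<and>
     (\<forall>t\<ge>0. G t = (LINT u:{0..t}|lebesgue. g u))"

text \<open>A solution of the discontinuous Volterra equation
  \<open>\<rho> t = \<rho>0 (1 - F t) + \<integral>\<^sub>0\<^sup>t 1[\<rho> (u-) < 1] (1 - G (t - u)) lam u du\<close>.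
  It is by definition a pair \<open>(\<rho>, z)\<close> in which \<open>z\<close> replaces the discontinuous
  indicator. Measurability of \<open>z\<close> makes the integral below a genuine one: its integrand
  is then dominated by \<open>lam\<close>.\<close>

definition volterra_solution ::
    "real \<Rightarrow> (real \<Rightarrow> real) \<Rightarrow> (real \<Rightarrow> real) \<Rightarrow> real \<Rightarrow> (real \<Rightarrow> real) \<Rightarrow>
     (real \<Rightarrow> real) \<Rightarrow> (real \<Rightarrow> real) \<Rightarrow> bool" where
  "volterra_solution T lam G \<rho>0 F \<rho> z \<longleftrightarrow>
     z \<in> borel_measurable (lebesgue_on {0..T}) \<and>
     (\<forall>t\<in>{0..T}. \<rho> t = \<rho>0 * (1 - F t) + (LINT u:{0..t}|lebesgue. z u * (1 - G (t - u)) * lam u)) \<and>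
     (\<forall>t\<in>{0..T}. 0 \<le> \<rho> t \<and> \<rho> t \<le> 1) \<and>
     (AE t in lebesgue_on {0..T}. indicator {s. \<rho> s < 1} t \<le> z t \<and> z t \<le> 1)"

text \<open>In the clause for \<open>z t * lam t\<close>, the convolution with \<open>g\<close> is finite for almost every \<open>t\<close> only;
  the remaining \<open>t\<close> are absorbed by the almost-everywhere quantifier. The \<open>else\<close> branch
  is the case \<open>\<rho> t = 1\<close>, as \<open>\<rho> t \<le> 1\<close>.\<close>

definition volterra_pair_system ::
    "real \<Rightarrow> (real \<Rightarrow> real) \<Rightarrow> (real \<Rightarrow> real) \<Rightarrow> (real \<Rightarrow> real) \<Rightarrow> real \<Rightarrow> (real \<Rightarrow> real) \<Rightarrow>
     (real \<Rightarrow> real) \<Rightarrow> (real \<Rightarrow> real) \<Rightarrow> (real \<Rightarrow> real) \<Rightarrow> bool" where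
  "volterra_pair_system T lam G g \<rho>0 F f \<rho> z \<longleftrightarrow>
     z \<in> borel_measurable (lebesgue_on {0..T}) \<and>
     (\<forall>t\<in>{0..T}. 0 \<le> \<rho> t \<and> \<rho> t \<le> 1) \<and>
     (\<forall>t\<in>{0..T}. \<rho> t = \<rho>0 * (1 - F t) + (LINT u:{0..t}|lebesgue. z u * lam u * (1 - G (t - u)))) \<and>
     (AE t in lebesgue_on {0..T}.
        z t * lam t =
          (if \<rho> t < 1 then lam t
           else \<rho>0 * f t + (LINT u:{0..t}|lebesgue. z u * lam u * g (t - u)))) \<and>
     (AE t in lebesgue_on {0..T}. indicator {s. \<rho> s < 1} t \<le> z t \<and> z t \<le> 1)"

end

theory Submission
  imports Defs "HOL-Real_Asymp.Real_Asymp"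
begin

text \<open>
  Put \<open>a = z \<lambda>\<close>. By Fubini \<open>\<rho>\<close> is absolutely continuous with density \<open>a - \<rho>\<^sub>0 f - a * g\<close>, and this
  density vanishes almost everywhere on the level set \<open>{\<rho> = 1}\<close>, which is the second equation of the
  system. For two solutions, integrating the derivative of \<open>\<bar>\<rho> - \<rho>'\<bar>\<close> gives
  \<open>\<bar>\<rho> t - \<rho>' t\<bar> + \<integral>\<^sub>0\<^sup>t \<bar>a - a'\<bar>(u) (1 - G (t - u)) du \<le> 0\<close>, hence uniqueness, as \<open>G < 1\<close> near 0.
  For existence, \<open>A t = \<integral>\<^sub>0\<^sup>t a\<close> solves a Skorokhod reflection problem at level 1: it is a fixed point of
  the map sending \<open>A\<close> to \<open>\<Lambda> - L\<close>, where \<open>\<Lambda> t = \<integral>\<^sub>0\<^sup>t \<lambda>\<close> and \<open>L\<close> is the running maximum of the positive part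
  of \<open>\<rho>\<^sub>0 (1 - F) + \<Lambda> - A * g - 1\<close>. This map is monotone and preserves the functions
  whose increments lie between 0 and those of \<open>\<Lambda>\<close>, so it has a fixed point, whose density exists by
  Radon--Nikodym.
\<close>

subsection \<open>Indefinite integrals\<close>

lemma set_integrable_if_integrable:
  fixes v :: "'a \<Rightarrow> real"
  assumes "integrable M v" and "S \<in> sets M"
  shows "set_integrable M S v"
  unfolding set_integrable_def by (rule integrable_mult_indicator[OF assms(2,1)])

lemma set_integral_Iic_diff:
  fixes v :: "real \<Rightarrow> real"
  assumes "integrable lborel v" and "s \<le> t"
  shows "(LBINT u:{..t}. v u) - (LBINT u:{..s}. v u) = (LBINT u:{s<..t}. v u)"
proof -
  have i: "set_integrable lborel S v" if "S \<in> sets borel" for S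
    using assms(1) that by (simp add: set_integrable_if_integrable)
  have "{..t} = {..s} \<union> {s<..t}" using assms(2) by auto
  then have "(LBINT u:{..t}. v u) = (LBINT u:{..s}. v u) + (LBINT u:{s<..t}. v u)"
    by (simp only:) (rule set_integral_Un; auto intro: i)
  then show ?thesis by simp
qed

lemma set_integral_Iic_nonpos:
  fixes q :: "real \<Rightarrow> real"
  assumes "\<And>u. u < 0 \<Longrightarrow> q u = 0" and "t \<le> 0"
  shows "(LBINT u:{..t}. q u) = 0"
proof -
  \<comment> \<open>For \<open>t = 0\<close> the ray contains the point 0, where \<open>q\<close> is
    unrestricted; it is discarded as a null set.\<close>
  have "AE u in lborel. u \<noteq> (0::real)" by (rule AE_lborel_singleton)
  then have "AE u in lborel. indicator {..t} u *\<^sub>R q u = 0"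
    by eventually_elim (use assms in \<open>auto simp: indicator_def\<close>)
  then show ?thesis
    unfolding set_lebesgue_integral_def by (rule integral_eq_zero_AE)
qed

lemma set_integral_Iic_mono:
  fixes q :: "real \<Rightarrow> real"
  assumes "integrable lborel q" and "\<And>u. 0 \<le> q u" and "s \<le> t"
  shows "(LBINT u:{..s}. q u) \<le> (LBINT u:{..t}. q u)"
proof -
  have "0 \<le> (LBINT u:{s<..t}. q u)"
    unfolding set_lebesgue_integral_def by (intro integral_nonneg_AE) (simp add: assms(2))
  then show ?thesis using set_integral_Iic_diff[OF assms(1,3)] by simp
qed

lemma set_integral_Iic_le:
  fixes q :: "real \<Rightarrow> real"
  assumes "integrable lborel q" and "\<And>u. 0 \<le> q u"
  shows "(LBINT u:{..t}. q u) \<le> (LBINT u. q u)"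
  unfolding set_lebesgue_integral_def
  using set_integrable_if_integrable[OF assms(1), of "{..t}"] assms
  by (intro integral_mono) (auto simp: set_integrable_def indicator_def)

lemma set_integral_Ioc_add:
  fixes v :: "real \<Rightarrow> real"
  assumes "set_integrable lborel {a<..c} v" and "a \<le> b" "b \<le> c"
  shows "(LBINT u:{a<..c}. v u) = (LBINT u:{a<..b}. v u) + (LBINT u:{b<..c}. v u)"
proof -
  have i: "set_integrable lborel S v" if "S \<in> sets borel" "S \<subseteq> {a<..c}" for S
    using that by (intro set_integrable_subset[OF assms(1)]) auto
  have e: "{a<..c} = {a<..b} \<union> {b<..c}" using assms(2,3) by auto
  show ?thesis unfolding e
    by (rule set_integral_Un; use assms(2,3) in \<open>auto intro!: i\<close>)
qed

lemma continuous_set_integral_Iic: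
  fixes v :: "real \<Rightarrow> real"
  assumes v: "integrable lborel v"
  shows "isCont (\<lambda>t. LBINT u:{..t}. v u) t"
  unfolding continuous_at_sequentially
proof (intro allI impI)
  fix x :: "nat \<Rightarrow> real" assume x: "x \<longlonglongrightarrow> t"
  note [measurable] = borel_measurable_integrable[OF v]
  have "(\<lambda>n. LBINT u. indicator {..x n} u *\<^sub>R v u) \<longlonglongrightarrow> (LBINT u. indicator {..t} u *\<^sub>R v u)"
  proof (rule integral_dominated_convergence[where w="\<lambda>u. \<bar>v u\<bar>"])
    \<comment> \<open>The indicators of \<open>{..x n}\<close> need not converge at
      \<open>u = t\<close>, but everywhere else they are eventually constant.\<close>
    have "AE u in lborel. u \<noteq> t" by (rule AE_lborel_singleton)
    then show "AE u in lborel. (\<lambda>n. indicator {..x n} u *\<^sub>R v u) \<longlonglongrightarrow> indicator {..t} u *\<^sub>R v u"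
    proof eventually_elim
      case (elim u)
      have "eventually (\<lambda>n. indicator {..x n} u *\<^sub>R v u = indicator {..t} u *\<^sub>R v u) sequentially"
      proof (cases "u < t")
        case True
        from order_tendstoD(1)[OF x True] show ?thesis
          by eventually_elim (use True in \<open>auto simp: indicator_def\<close>)
      next
        case False
        then have "t < u" using elim by simp
        from order_tendstoD(2)[OF x this] show ?thesis
          by eventually_elim (use \<open>t < u\<close> in \<open>auto simp: indicator_def\<close>)
      qed
      then show ?case by (rule tendsto_eventually)
    qed
  qed (use v in \<open>auto simp: indicator_def\<close>)
  then show "((\<lambda>t. LBINT u:{..t}. v u) \<circ> x) \<longlonglongrightarrow> (LBINT u:{..t}. v u)"
    by (simp add: set_lebesgue_integral_def comp_def)
qed

lemma finite_borel_measure_density: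
  fixes q :: "real \<Rightarrow> real"
  assumes "integrable lborel q" "\<And>u. 0 \<le> q u"
  shows "finite_borel_measure (density lborel (\<lambda>u. ennreal (q u)))"
proof (intro finite_borel_measure.intro finite_measureI finite_borel_measure_axioms.intro)
  show "emeasure (density lborel (\<lambda>u. ennreal (q u))) (space (density lborel (\<lambda>u. ennreal (q u)))) \<noteq> \<infinity>"
    using assms
    by (simp add: emeasure_density nn_integral_eq_integral borel_measurable_integrable cong: nn_integral_cong)
qed simp

lemma cdf_density:
  fixes q :: "real \<Rightarrow> real"
  assumes "integrable lborel q" "\<And>u. 0 \<le> q u"
  shows "cdf (density lborel (\<lambda>u. ennreal (q u))) x = (LBINT u:{..x}. q u)"
proof -
  have [measurable]: "q \<in> borel_measurable borel" using assms by auto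
  have i: "integrable lborel (\<lambda>u. indicator {..x} u *\<^sub>R q u)"
    using assms by (intro integrable_mult_indicator) auto
  have "emeasure (density lborel (\<lambda>u. ennreal (q u))) {..x}
      = (\<integral>\<^sup>+u. ennreal (indicator {..x} u *\<^sub>R q u) \<partial>lborel)"
    by (subst emeasure_density) (auto intro!: nn_integral_cong simp: indicator_def)
  also have "\<dots> = ennreal (LBINT u:{..x}. q u)"
    unfolding set_lebesgue_integral_def using i assms(2) by (intro nn_integral_eq_integral) auto
  finally show ?thesis
    using assms(2) by (simp add: cdf_def measure_def set_lebesgue_integral_def integral_nonneg_AE)
qed

text \<open>The positive and negative parts of \<open>h\<close> are densities of finite measures
  with the same distribution function, so they agree almost everywhere. As one of the two parts is
  zero at each point, both are.\<close>

lemma AE_zero_if_set_integral_Iic_zero: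
  fixes h :: "real \<Rightarrow> real"
  assumes h: "integrable lborel h" and zero: "\<And>x. (LBINT u:{..x}. h u) = 0"
  shows "AE u in lborel. h u = 0"
proof -
  note [measurable] = borel_measurable_integrable[OF h]
  define p where "p u = max 0 (h u)" for u
  define n where "n u = max 0 (- h u)" for u
  have [measurable]: "p \<in> borel_measurable borel" "n \<in> borel_measurable borel"
    unfolding p_def n_def by measurable
  have int: "integrable lborel p" "integrable lborel n"
    unfolding p_def n_def using h by auto
  have nn: "0 \<le> p u" "0 \<le> n u" for u
    by (simp_all add: p_def n_def)
  have "density lborel (\<lambda>u. ennreal (p u)) = density lborel (\<lambda>u. ennreal (n u))"
  proof (rule cdf_unique')
    show "cdf (density lborel (\<lambda>u. ennreal (p u))) = cdf (density lborel (\<lambda>u. ennreal (n u)))"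
    proof
      fix x
      have "(LBINT u:{..x}. p u) - (LBINT u:{..x}. n u) = (LBINT u:{..x}. p u - n u)"
        by (rule set_integral_diff(2)[symmetric])
           (use int in \<open>auto intro!: set_integrable_if_integrable\<close>)
      also have "\<dots> = (LBINT u:{..x}. h u)"
        by (rule arg_cong[where f="set_lebesgue_integral lborel {..x}"]) (auto simp: p_def n_def)
      finally have "(LBINT u:{..x}. p u) = (LBINT u:{..x}. n u)" using zero by simp
      then show "cdf (density lborel (\<lambda>u. ennreal (p u))) x = cdf (density lborel (\<lambda>u. ennreal (n u))) x"
        using int nn by (simp add: cdf_density)
    qed
  qed (use int nn in \<open>auto intro!: finite_borel_measure_density\<close>)
  then have "AE u in lborel. ennreal (p u) = ennreal (n u)"
    by (intro sigma_finite_measure.density_unique[OF lborel.sigma_finite_measure_axioms]) auto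
  then show ?thesis
    by eventually_elim (auto simp: p_def n_def max_def split: if_splits)
qed

subsection \<open>Densities of functions with dominated increments\<close>

text \<open>The rays \<open>{..x}\<close> are stable under intersection and generate the Borel sets,
  so Dynkin's lemma extends the identity from rays to all Borel sets.\<close>

lemma measure_add_eq_if_cdf_add_eq:
  assumes N: "finite_borel_measure N" and P: "finite_borel_measure P" and M: "finite_borel_measure M"
    and cdf: "\<And>x. cdf N x + cdf P x = cdf M x" and "X \<in> sets borel"
  shows "measure N X + measure P X = measure M X"
proof -
  interpret N: finite_borel_measure N by fact
  interpret P: finite_borel_measure P by fact
  interpret M: finite_borel_measure M by fact
  \<comment> \<open>The complement step needs the total masses. They are limits of the distribution
    functions, since the whole line is not a ray.\<close>
  have UNIV: "measure N UNIV + measure P UNIV = measure M UNIV"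
  proof (rule LIMSEQ_unique)
    show "(\<lambda>i. cdf N (real i) + cdf P (real i)) \<longlonglongrightarrow> measure N UNIV + measure P UNIV"
      using N.cdf_lim_infty P.cdf_lim_infty by (intro tendsto_add) (simp_all add: N.borel_UNIV P.borel_UNIV)
    show "(\<lambda>i. cdf N (real i) + cdf P (real i)) \<longlonglongrightarrow> measure M UNIV"
      using M.cdf_lim_infty by (simp add: cdf M.borel_UNIV)
  qed
  have gen: "sigma_sets UNIV (range atMost) = sets (borel :: real measure)"
    by (subst borel_eq_atMost) simp
  have "Int_stable (range atMost :: real set set)"
    by (auto simp: Int_stable_def Int_atMost)
  moreover have "range atMost \<subseteq> Pow (UNIV :: real set)" by simp
  moreover have "X \<in> sigma_sets UNIV (range atMost)" using \<open>X \<in> sets borel\<close> by (simp add: gen)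
  ultimately show ?thesis
  proof (induction rule: sigma_sets_induct_disjoint)
    case (basic A)
    then show ?case using cdf by (auto simp: cdf_def)
  next
    case (compl A)
    then have "A \<in> sets borel" by (simp add: gen)
    then have "measure N (UNIV - A) = measure N UNIV - measure N A"
      "measure P (UNIV - A) = measure P UNIV - measure P A"
      "measure M (UNIV - A) = measure M UNIV - measure M A"
      using N.finite_measure_compl[of A] P.finite_measure_compl[of A] M.finite_measure_compl[of A]
      by (auto simp: N.borel_UNIV P.borel_UNIV M.borel_UNIV)
    with compl UNIV show ?case by simp
  next
    case (union A)
    then have A: "range A \<subseteq> sets borel" by (simp add: gen)
    have "(\<lambda>i. measure N (A i) + measure P (A i)) sums (measure N (\<Union>i. A i) + measure P (\<Union>i. A i))"
      using A union by (intro sums_add N.finite_measure_UNION P.finite_measure_UNION) auto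
    moreover have "(\<lambda>i. measure M (A i)) sums measure M (\<Union>i. A i)"
      using A union by (intro M.finite_measure_UNION) auto
    ultimately show ?case using union(3) by (simp add: sums_unique2)
  qed simp
qed

lemma finite_borel_measure_interval_measure_bounded:
  fixes A :: "real \<Rightarrow> real"
  assumes mono: "\<And>s t. s \<le> t \<Longrightarrow> A s \<le> A t" and cont: "\<And>t. isCont A t"
    and neg: "\<And>t. t \<le> 0 \<Longrightarrow> A t = 0" and bound: "\<And>t. A t \<le> B"
  shows "finite_borel_measure (interval_measure A)" and "cdf (interval_measure A) = A"
proof -
  have rc: "continuous (at_right t) A" for t
    using cont[of t] by (rule continuous_within_subset) simp
  have bot: "(A \<longlongrightarrow> 0) at_bot"
    by (rule tendsto_eventually) (auto simp: eventually_at_bot_linorder intro!: exI[of _ 0] neg)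
  have "incseq (\<lambda>i. A (real i))" by (auto simp: incseq_def intro: mono)
  then obtain m where m: "(\<lambda>i. A (real i)) \<longlonglongrightarrow> m"
    using incseq_convergent[of _ B] bound by blast
  then have top: "(A \<longlongrightarrow> m) at_top"
    by (intro tendsto_at_topI_sequentially_real) (auto simp: mono_def mono)
  have "0 \<le> A (real i)" for i using mono[of 0 "real i"] neg[of 0] by simp
  then have "0 \<le> m" by (intro LIMSEQ_le_const[OF m]) auto
  show "finite_borel_measure (interval_measure A)"
    by (rule finite_borel_measure_interval_measure[OF mono rc bot top \<open>0 \<le> m\<close>])
  show "cdf (interval_measure A) = A"
    by (rule cdf_interval_measure[OF mono rc bot])
qed

text \<open>Both \<open>A\<close> and \<open>\<Lambda> - A\<close> are distribution functions of
  finite measures, and these add up to the measure with density \<open>l\<close>. So both are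
  absolutely continuous, and their Radon-Nikodym densities are nonnegative with sum
  \<open>l\<close>, which bounds the density of \<open>A\<close> by \<open>l\<close>.\<close>

lemma density_of_dominated_increments:
  fixes A l :: "real \<Rightarrow> real"
  defines "\<Lambda> \<equiv> \<lambda>t. LBINT u:{..t}. l u"
  assumes l: "integrable lborel l" and l_nonneg: "\<And>u. 0 \<le> l u" and l_neg: "\<And>u. u < 0 \<Longrightarrow> l u = 0"
    and mono: "\<And>s t. s \<le> t \<Longrightarrow> A s \<le> A t" and dom: "\<And>s t. s \<le> t \<Longrightarrow> A t - A s \<le> \<Lambda> t - \<Lambda> s"
    and neg: "\<And>t. t \<le> 0 \<Longrightarrow> A t = 0"
  obtains a where "a \<in> borel_measurable borel" and "\<And>u. 0 \<le> a u \<and> a u \<le> l u"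
    and "\<And>t. A t = (LBINT u:{..t}. a u)"
proof -
  have [measurable]: "l \<in> borel_measurable borel" using l by auto
  have \<Lambda>_cont: "isCont \<Lambda> t" for t unfolding \<Lambda>_def by (rule continuous_set_integral_Iic[OF l])
  have \<Lambda>_neg: "\<Lambda> t = 0" if "t \<le> 0" for t
    unfolding \<Lambda>_def by (rule set_integral_Iic_nonpos[OF l_neg that])
  have \<Lambda>_le: "\<Lambda> t \<le> (LBINT u. l u)" for t
    unfolding \<Lambda>_def by (rule set_integral_Iic_le[OF l l_nonneg])
  have A_nonneg: "0 \<le> A t" for t using mono[of 0 t] mono[of t 0] neg[of 0] neg[of t] by (cases "t \<le> 0") auto
  have A_le: "A t \<le> \<Lambda> t" for t
    using dom[of "min t 0" t] neg[of "min t 0"] \<Lambda>_neg[of "min t 0"] by simp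
  have A_cont: "isCont A t" for t
  proof -
    have close: "\<bar>A s - A t\<bar> \<le> \<bar>\<Lambda> s - \<Lambda> t\<bar>" for s
      using mono[of s t] mono[of t s] dom[of s t] dom[of t s] by (cases "s \<le> t") auto
    have "((\<lambda>s. \<Lambda> s - \<Lambda> t) \<longlongrightarrow> 0) (at t)"
      using \<Lambda>_cont[of t] by (simp add: isCont_def LIM_zero_iff)
    then have "((\<lambda>s. A s - A t) \<longlongrightarrow> 0) (at t)"
      by (rule Lim_null_comparison[OF _ tendsto_rabs_zero, rotated]) (use close in auto)
    then show ?thesis by (simp add: isCont_def LIM_zero_iff)
  qed
  define N where "N = interval_measure A"
  define P where "P = interval_measure (\<lambda>t. \<Lambda> t - A t)"
  define M where "M = density lborel (\<lambda>u. ennreal (l u))"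
  have N: "finite_borel_measure N" "cdf N = A"
    unfolding N_def
    by (rule finite_borel_measure_interval_measure_bounded[OF mono A_cont neg order_trans[OF A_le \<Lambda>_le]]; assumption)+
  have P: "finite_borel_measure P" "cdf P = (\<lambda>t. \<Lambda> t - A t)"
    unfolding P_def
  proof -
    have 1: "\<Lambda> s - A s \<le> \<Lambda> t - A t" if "s \<le> t" for s t using dom[OF that] by simp
    have 2: "isCont (\<lambda>t. \<Lambda> t - A t) t" for t using \<Lambda>_cont A_cont by (intro continuous_intros)
    have 3: "\<Lambda> t - A t = 0" if "t \<le> 0" for t using that neg \<Lambda>_neg by simp
    have 4: "\<Lambda> t - A t \<le> (LBINT u. l u)" for t using A_nonneg[of t] \<Lambda>_le[of t] by simp
    show "finite_borel_measure (interval_measure (\<lambda>t. \<Lambda> t - A t))"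
      "cdf (interval_measure (\<lambda>t. \<Lambda> t - A t)) = (\<lambda>t. \<Lambda> t - A t)"
      by (rule finite_borel_measure_interval_measure_bounded[OF 1 2 3 4]; assumption)+
  qed
  have M: "finite_borel_measure M" "cdf M = \<Lambda>"
    unfolding M_def \<Lambda>_def using l l_nonneg
    by (auto simp: finite_borel_measure_density cdf_density fun_eq_iff)
  interpret N: finite_borel_measure N by fact
  interpret P: finite_borel_measure P by fact
  interpret M: finite_borel_measure M by fact
  have add: "emeasure N X + emeasure P X = emeasure M X" if "X \<in> sets borel" for X
    using measure_add_eq_if_cdf_add_eq[OF N(1) P(1) M(1) _ that] N(2) P(2) M(2)
    by (simp add: N.emeasure_eq_measure P.emeasure_eq_measure M.emeasure_eq_measure ennreal_plus[symmetric] del: ennreal_plus)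
  have M_null: "emeasure M X = 0" if "X \<in> null_sets lborel" for X
    using that absolutely_continuousI_density[of "\<lambda>u. ennreal (l u)" lborel]
    by (auto simp: absolutely_continuous_def M_def)
  have NP_null: "emeasure N X = 0 \<and> emeasure P X = 0" if "X \<in> null_sets lborel" for X
    using add[of X] M_null[OF that] null_setsD2[OF that] by simp
  have ac: "absolutely_continuous lborel N" "absolutely_continuous lborel P"
    unfolding absolutely_continuous_def
    using NP_null by (auto simp: N_def P_def intro!: null_setsI dest: null_setsD2)
  obtain \<alpha> \<beta> where [measurable]: "\<alpha> \<in> borel_measurable lborel" "\<beta> \<in> borel_measurable lborel"
    and \<alpha>: "density lborel \<alpha> = N" and \<beta>: "density lborel \<beta> = P"
    using sigma_finite_measure.Radon_Nikodym[OF lborel.sigma_finite_measure_axioms ac(1)]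
      sigma_finite_measure.Radon_Nikodym[OF lborel.sigma_finite_measure_axioms ac(2)]
    by (auto simp: N_def P_def)
  have "density lborel (\<lambda>u. \<alpha> u + \<beta> u) = M"
  proof (rule measure_eqI)
    fix X assume "X \<in> sets (density lborel (\<lambda>u. \<alpha> u + \<beta> u))"
    then have X: "X \<in> sets borel" by simp
    then have "emeasure (density lborel (\<lambda>u. \<alpha> u + \<beta> u)) X = emeasure (density lborel \<alpha>) X + emeasure (density lborel \<beta>) X"
      by (simp add: emeasure_density distrib_right nn_integral_add)
    then show "emeasure (density lborel (\<lambda>u. \<alpha> u + \<beta> u)) X = emeasure M X"
      using add[OF X] by (simp add: \<alpha> \<beta>)
  qed (simp add: M_def)
  then have sum: "AE u in lborel. \<alpha> u + \<beta> u = ennreal (l u)"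
    unfolding M_def
    by (intro sigma_finite_measure.density_unique[OF lborel.sigma_finite_measure_axioms]) auto
  \<comment> \<open>Taking the minimum with \<open>l\<close> makes the bound hold at every point and
    changes the density only on a null set.\<close>
  define a where "a u = min (l u) (enn2real (\<alpha> u))" for u
  have a: "a \<in> borel_measurable borel" "0 \<le> a u" "a u \<le> l u" for u
    unfolding a_def using l_nonneg by auto
  have a_int: "integrable lborel a"
    by (rule Bochner_Integration.integrable_bound[OF l]) (use a l_nonneg in auto)
  have "AE u in lborel. \<alpha> u = ennreal (a u)"
    using sum
  proof eventually_elim
    case (elim u)
    then have "\<alpha> u \<le> ennreal (l u)" by (metis le_iff_add)
    moreover from this have "\<alpha> u < top" by (simp add: le_less_trans)
    ultimately have "enn2real (\<alpha> u) \<le> l u" using l_nonneg[of u] by (metis enn2real_leI)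
    then show ?case using \<open>\<alpha> u < top\<close> by (simp add: a_def min_def)
  qed
  then have "N = density lborel (\<lambda>u. ennreal (a u))"
    unfolding \<alpha>[symmetric] using a by (intro density_cong) auto
  then have "A t = (LBINT u:{..t}. a u)" for t
    using cdf_density[OF a_int a(2)] N(2) by simp
  with a that show thesis by blast
qed

subsection \<open>The chain rule\<close>

lemma mean_value_between:
  fixes \<Phi> \<Phi>' :: "real \<Rightarrow> real"
  assumes "\<And>x. (\<Phi> has_real_derivative \<Phi>' x) (at x)"
  shows "\<exists>\<xi>. min x y \<le> \<xi> \<and> \<xi> \<le> max x y \<and> \<Phi> y - \<Phi> x = \<Phi>' \<xi> * (y - x)"
proof (cases x y rule: linorder_cases)
  case less
  then obtain z where "x < z" "z < y" "\<Phi> y - \<Phi> x = (y - x) * \<Phi>' z"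
    using MVT2[of x y \<Phi> \<Phi>'] assms by blast
  with less show ?thesis by (intro exI[of _ z]) (simp add: mult.commute)
next
  case greater
  then obtain z where "y < z" "z < x" "\<Phi> x - \<Phi> y = (x - y) * \<Phi>' z"
    using MVT2[of y x \<Phi> \<Phi>'] assms by blast
  with greater show ?thesis by (intro exI[of _ z]) (simp add: algebra_simps)
qed auto

text \<open>The proof never differentiates \<open>w\<close>. On a short interval the mean value
  theorem replaces \<open>\<Phi>' (w u)\<close> by its value at one point, with an error of at most
  \<open>\<epsilon>\<close> times the integral of \<open>\<bar>v\<bar>\<close>. Both the error
  \<open>R\<close> and the variation \<open>V\<close> are additive over adjacent intervals, so the
  same bound holds on \<open>{a<..b}\<close> for every \<open>\<epsilon>\<close>.\<close>

lemma chain_rule_set_integral: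
  fixes v w \<Phi> \<Phi>' :: "real \<Rightarrow> real"
  assumes v: "integrable lborel v" and w: "\<And>t. w t = c + (LBINT u:{..t}. v u)"
    and \<Phi>: "\<And>x. (\<Phi> has_real_derivative \<Phi>' x) (at x)" and \<Phi>': "continuous_on UNIV \<Phi>'"
    and "a \<le> b"
  shows "\<Phi> (w b) - \<Phi> (w a) = (LBINT u:{a<..b}. \<Phi>' (w u) * v u)"
proof -
  define q where "q u = \<Phi>' (w u)" for u
  have wc: "isCont w x" for x
    using continuous_set_integral_Iic[OF v, of x] by (simp add: w[abs_def])
  have wcon: "continuous_on S w" for S using wc by (simp add: continuous_at_imp_continuous_on)
  have qc: "continuous_on UNIV q"
    unfolding q_def by (rule continuous_on_compose2[OF \<Phi>' wcon]) auto
  have [measurable]: "q \<in> borel_measurable borel"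
    using qc by (rule borel_measurable_continuous_onI)
  have [measurable]: "v \<in> borel_measurable borel" using v by auto
  obtain B where B: "\<And>u. u \<in> {a..b} \<Longrightarrow> \<bar>q u\<bar> \<le> B"
    using compact_continuous_image[OF continuous_on_subset[OF qc] compact_Icc, of a b]
    by (force dest: compact_imp_bounded simp: bounded_iff)
  have sub: "set_integrable lborel S (\<lambda>u. q u * v u)" if "S \<in> sets borel" "S \<subseteq> {a..b}" for S
    unfolding set_integrable_def
  proof (rule Bochner_Integration.integrable_bound)
    show "integrable lborel (\<lambda>u. B * v u)" using v by simp
    show "AE u in lborel. norm (indicat_real S u *\<^sub>R (q u * v u)) \<le> norm (B * v u)"
    proof (rule AE_I2)
      fix u
      show "norm (indicat_real S u *\<^sub>R (q u * v u)) \<le> norm (B * v u)"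
      proof (cases "u \<in> S")
        case True
        then have "\<bar>q u\<bar> \<le> B" using B that by auto
        then have "\<bar>q u\<bar> * \<bar>v u\<bar> \<le> \<bar>B\<bar> * \<bar>v u\<bar>" by (intro mult_right_mono) auto
        with True show ?thesis by (simp add: abs_mult)
      qed simp
    qed
  qed (use that in measurable)
  have subv: "set_integrable lborel S v" if "S \<in> sets borel" for S
    using that v by (simp add: set_integrable_if_integrable)
  define R where "R s t = \<Phi> (w t) - \<Phi> (w s) - (LBINT u:{s<..t}. q u * v u)" for s t
  define V where "V s t = (LBINT u:{s<..t}. \<bar>v u\<bar>)" for s t
  have subav: "set_integrable lborel S (\<lambda>u. \<bar>v u\<bar>)" if "S \<in> sets borel" for S
    using that v by (simp add: set_integrable_if_integrable)
  have V_add: "V s t = V s r + V r t" if "s \<le> r" "r \<le> t" for s r t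
    unfolding V_def using that by (intro set_integral_Ioc_add subav) auto
  have R_add: "R s t = R s r + R r t" if "a \<le> s" "s \<le> r" "r \<le> t" "t \<le> b" for s r t
    unfolding R_def using that
    by (subst set_integral_Ioc_add[of s t "\<lambda>u. q u * v u" r]) (auto intro!: sub)
  have V_nn: "0 \<le> V s t" for s t
    unfolding V_def set_lebesgue_integral_def by (intro integral_nonneg_AE) auto
  have small: "\<bar>R a b\<bar> \<le> \<epsilon> * V a b" if "0 < \<epsilon>" for \<epsilon>
  proof -
    have "uniformly_continuous_on {a..b} q"
      using continuous_on_subset[OF qc] by (intro compact_uniformly_continuous) auto
    then obtain \<delta> where "0 < \<delta>" and
      \<delta>: "\<And>x y. x \<in> {a..b} \<Longrightarrow> y \<in> {a..b} \<Longrightarrow> dist y x < \<delta> \<Longrightarrow> dist (q y) (q x) < \<epsilon>"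
      unfolding uniformly_continuous_on_def using \<open>0 < \<epsilon>\<close> by metis
    have step: "\<bar>R s t\<bar> \<le> \<epsilon> * V s t" if "a \<le> s" "s \<le> t" "t \<le> b" "t - s < \<delta>" for s t
    proof -
      obtain x where x: "min (w s) (w t) \<le> x" "x \<le> max (w s) (w t)"
        "\<Phi> (w t) - \<Phi> (w s) = \<Phi>' x * (w t - w s)"
        using mean_value_between[OF \<Phi>] by blast
      \<comment> \<open>The mean value theorem gives a point in the range of \<open>w\<close>; the
        intermediate value theorem pulls it back to a time in \<open>{s..t}\<close>, where uniform
        continuity of \<open>q\<close> applies.\<close>
      obtain \<xi> where \<xi>: "s \<le> \<xi>" "\<xi> \<le> t" "w \<xi> = x"
      proof (cases "w s \<le> w t")
        case True
        then show ?thesis using IVT[of w s x t] x wc that \<open>s \<le> t\<close> by auto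
      next
        case False
        then show ?thesis using IVT2[of w t x s] x wc that \<open>s \<le> t\<close> by auto
      qed
      have wd: "w t - w s = (LBINT u:{s<..t}. v u)"
        using set_integral_Iic_diff[OF v \<open>s \<le> t\<close>] by (simp add: w)
      have "R s t = (LBINT u:{s<..t}. q \<xi> * v u) - (LBINT u:{s<..t}. q u * v u)"
        unfolding R_def x(3) wd by (simp add: q_def \<xi>)
      also have "\<dots> = (LBINT u:{s<..t}. q \<xi> * v u - q u * v u)"
        using that by (intro set_integral_diff(2)[symmetric] sub set_integrable_mult_right subv) auto
      finally have "\<bar>R s t\<bar> = \<bar>LBINT u:{s<..t}. q \<xi> * v u - q u * v u\<bar>" by simp
      also have "\<dots> \<le> (LBINT u. \<bar>indicator {s<..t} u *\<^sub>R (q \<xi> * v u - q u * v u)\<bar>)"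
        unfolding set_lebesgue_integral_def by (rule integral_abs_bound)
      also have "\<dots> \<le> (LBINT u. indicator {s<..t} u *\<^sub>R (\<epsilon> * \<bar>v u\<bar>))"
      proof (rule integral_mono)
        have "set_integrable lborel {s<..t} (\<lambda>u. q \<xi> * v u - q u * v u)"
          using that by (intro set_integral_diff(1) sub set_integrable_mult_right subv) auto
        then show "integrable lborel (\<lambda>u. \<bar>indicat_real {s<..t} u *\<^sub>R (q \<xi> * v u - q u * v u)\<bar>)"
          by (simp add: set_integrable_def)
        have "set_integrable lborel {s<..t} (\<lambda>u. \<epsilon> * \<bar>v u\<bar>)"
          by (intro set_integrable_mult_right subav) auto
        then show "integrable lborel (\<lambda>u. indicat_real {s<..t} u *\<^sub>R (\<epsilon> * \<bar>v u\<bar>))"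
          by (simp add: set_integrable_def)
        fix u
        show "\<bar>indicat_real {s<..t} u *\<^sub>R (q \<xi> * v u - q u * v u)\<bar>
            \<le> indicat_real {s<..t} u *\<^sub>R (\<epsilon> * \<bar>v u\<bar>)"
        proof (cases "u \<in> {s<..t}")
          case True
          have "dist (q \<xi>) (q u) < \<epsilon>"
            using True that \<xi> by (intro \<delta>) (auto simp: dist_real_def)
          then have "\<bar>q \<xi> - q u\<bar> * \<bar>v u\<bar> \<le> \<epsilon> * \<bar>v u\<bar>"
            by (intro mult_right_mono) (auto simp: dist_real_def)
          then show ?thesis using True by (simp add: abs_mult[symmetric] algebra_simps)
        qed simp
      qed
      also have "\<dots> = \<epsilon> * V s t"
        unfolding V_def by (simp add: set_lebesgue_integral_def mult.left_commute)
      finally show ?thesis .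
    qed
    \<comment> \<open>The bound is carried to the right in steps of \<open>\<delta> / 2\<close>,
      which is strictly below the \<open>\<delta>\<close> that \<open>step\<close> allows.\<close>
    have *: "a \<le> t \<longrightarrow> t \<le> b \<longrightarrow> t \<le> a + real n * (\<delta> / 2) \<longrightarrow> \<bar>R a t\<bar> \<le> \<epsilon> * V a t" for n t
    proof (induction n arbitrary: t)
      case 0
      then show ?case using step[of a t] \<open>0 < \<delta>\<close> by auto
    next
      case (Suc n)
      show ?case
      proof (intro impI)
        assume t: "a \<le> t" "t \<le> b" "t \<le> a + real (Suc n) * (\<delta> / 2)"
        \<comment> \<open>The last step starts at \<open>r\<close>; the maximum keeps it from
          falling to the left of \<open>a\<close>.\<close>
        define r where "r = max a (t - \<delta> / 2)"
        have "t - \<delta> / 2 \<le> a + real n * (\<delta> / 2)"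
          using t(3) by (simp add: distrib_right add_divide_distrib)
        moreover have "0 \<le> real n * (\<delta> / 2)" using \<open>0 < \<delta>\<close> by simp
        ultimately have r: "a \<le> r" "r \<le> t" "r \<le> b" "t - r < \<delta>" "r \<le> a + real n * (\<delta> / 2)"
          using t(1,2) \<open>0 < \<delta>\<close> unfolding r_def max_def by (simp_all split: if_split)
        have "\<bar>R a t\<bar> \<le> \<bar>R a r\<bar> + \<bar>R r t\<bar>"
          using R_add[of a r t] r t by simp
        also have "\<dots> \<le> \<epsilon> * V a r + \<epsilon> * V r t"
          using Suc r t step[of r t] by (intro add_mono) auto
        also have "\<dots> = \<epsilon> * V a t" using V_add[of a r t] r by (simp add: algebra_simps)
        finally show "\<bar>R a t\<bar> \<le> \<epsilon> * V a t" .
      qed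
    qed
    obtain n where "(b - a) / (\<delta> / 2) \<le> real n" using real_arch_simple by blast
    then have "b \<le> a + real n * (\<delta> / 2)" using \<open>0 < \<delta>\<close> by (simp add: field_simps)
    with *[of b n] \<open>a \<le> b\<close> show ?thesis by auto
  qed
  have "\<bar>R a b\<bar> \<le> 0"
  proof (rule field_le_epsilon)
    fix e :: real assume "0 < e"
    \<comment> \<open>The summand 1 keeps the denominator positive when the variation is
      zero.\<close>
    have "\<bar>R a b\<bar> \<le> e / (V a b + 1) * V a b"
      using \<open>0 < e\<close> V_nn[of a b] by (intro small) (auto intro!: divide_pos_pos)
    also have "\<dots> \<le> e" using \<open>0 < e\<close> V_nn[of a b] by (simp add: field_simps)
    finally show "\<bar>R a b\<bar> \<le> 0 + e" by simp
  qed
  then show ?thesis by (simp add: R_def q_def)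
qed

text \<open>Extends the chain rule to pointwise limits of smooth functions. Since the derivatives
  are bounded by 1, \<open>\<bar>v\<bar>\<close> dominates the integrands. The limit
  \<open>\<psi>\<close> of the derivatives need not be continuous, nor be the derivative of
  \<open>\<phi>\<close>.\<close>

lemma chain_rule_limit:
  fixes v w \<phi> \<psi> :: "real \<Rightarrow> real" and \<Phi> \<Phi>' :: "nat \<Rightarrow> real \<Rightarrow> real"
  assumes v: "integrable lborel v" and w: "\<And>t. w t = c + (LBINT u:{..t}. v u)"
    and \<Phi>: "\<And>n x. (\<Phi> n has_real_derivative \<Phi>' n x) (at x)"
    and \<Phi>': "\<And>n. continuous_on UNIV (\<Phi>' n)" and bound: "\<And>n x. \<bar>\<Phi>' n x\<bar> \<le> 1"
    and lim: "\<And>x. (\<lambda>n. \<Phi> n x) \<longlonglongrightarrow> \<phi> x" and lim': "\<And>x. (\<lambda>n. \<Phi>' n x) \<longlonglongrightarrow> \<psi> x"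
    and "a \<le> b"
  shows "\<phi> (w b) - \<phi> (w a) = (LBINT u:{a<..b}. \<psi> (w u) * v u)"
proof (rule LIMSEQ_unique)
  have [measurable]: "v \<in> borel_measurable borel" using v by auto
  have "continuous_on UNIV w"
    using continuous_set_integral_Iic[OF v] by (simp add: continuous_at_imp_continuous_on w[abs_def])
  then have [measurable]: "w \<in> borel_measurable borel" by (rule borel_measurable_continuous_onI)
  have [measurable]: "\<Phi>' n \<in> borel_measurable borel" for n
    using \<Phi>' by (rule borel_measurable_continuous_onI)
  have [measurable]: "\<psi> \<in> borel_measurable borel"
    by (rule borel_measurable_LIMSEQ_real[of _ \<Phi>']) (use lim' in auto)
  show "(\<lambda>n. \<Phi> n (w b) - \<Phi> n (w a)) \<longlonglongrightarrow> \<phi> (w b) - \<phi> (w a)"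
    by (intro tendsto_diff lim)
  have "(\<lambda>n. LBINT u:{a<..b}. \<Phi>' n (w u) * v u) \<longlonglongrightarrow> (LBINT u:{a<..b}. \<psi> (w u) * v u)"
    unfolding set_lebesgue_integral_def
  proof (rule integral_dominated_convergence[where w="\<lambda>u. \<bar>v u\<bar>"])
    show "AE u in lborel. (\<lambda>n. indicat_real {a<..b} u *\<^sub>R (\<Phi>' n (w u) * v u))
        \<longlonglongrightarrow> indicat_real {a<..b} u *\<^sub>R (\<psi> (w u) * v u)"
      by (intro AE_I2 tendsto_intros lim')
    show "AE u in lborel. norm (indicat_real {a<..b} u *\<^sub>R (\<Phi>' n (w u) * v u)) \<le> \<bar>v u\<bar>" for n
      using mult_right_mono[OF bound] by (auto simp: abs_mult indicator_def)
  qed (use v in auto)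
  then show "(\<lambda>n. \<Phi> n (w b) - \<Phi> n (w a)) \<longlonglongrightarrow> (LBINT u:{a<..b}. \<psi> (w u) * v u)"
    by (simp add: chain_rule_set_integral[OF v w \<Phi> \<Phi>' \<open>a \<le> b\<close>])
qed

lemma abs_set_integral_Iic:
  fixes v w :: "real \<Rightarrow> real"
  assumes v: "integrable lborel v" and w: "\<And>t. w t = c + (LBINT u:{..t}. v u)" and "a \<le> b"
  shows "\<bar>w b\<bar> - \<bar>w a\<bar> = (LBINT u:{a<..b}. sgn (w u) * v u)"
proof -
  \<comment> \<open>The smooth functions \<open>sqrt (x\<^sup>2 + e n)\<close> approximate
    \<open>\<bar>x\<bar>\<close>; their derivatives vanish at 0, which matches
    \<open>sgn 0 = 0\<close>.\<close>
  define e where "e n = 1 / real (Suc n)" for n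
  have e: "0 < e n" for n by (simp add: e_def)
  have pos: "0 < x\<^sup>2 + e n" for x n using e[of n] by (simp add: add_nonneg_pos)
  have e0: "e \<longlonglongrightarrow> 0" unfolding e_def using LIMSEQ_inverse_real_of_nat by (simp add: inverse_eq_divide)
  have lim: "(\<lambda>n. sqrt (x\<^sup>2 + e n)) \<longlonglongrightarrow> \<bar>x\<bar>" for x
    using tendsto_real_sqrt[OF tendsto_add[OF tendsto_const[of "x\<^sup>2"] e0]] by simp
  show ?thesis
  proof (rule chain_rule_limit[where \<phi>=abs and \<Phi>="\<lambda>n x. sqrt (x\<^sup>2 + e n)"
        and \<Phi>'="\<lambda>n x. x / sqrt (x\<^sup>2 + e n)" and \<psi>=sgn, OF v w])
    show "((\<lambda>x. sqrt (x\<^sup>2 + e n)) has_real_derivative x / sqrt (x\<^sup>2 + e n)) (at x)" for n x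
      using pos[of x n] by (auto intro!: derivative_eq_intros simp: field_simps)
    show "continuous_on UNIV (\<lambda>x. x / sqrt (x\<^sup>2 + e n))" for n
      using pos by (intro continuous_intros) (auto simp: less_imp_neq[symmetric])
    show "\<bar>x / sqrt (x\<^sup>2 + e n)\<bar> \<le> 1" for n x
    proof -
      have "\<bar>x\<bar> \<le> sqrt (x\<^sup>2 + e n)" using e[of n] by (intro real_le_rsqrt) simp
      then show ?thesis using pos[of x n] by (simp add: divide_le_eq)
    qed
    show "(\<lambda>n. x / sqrt (x\<^sup>2 + e n)) \<longlonglongrightarrow> sgn x" for x
    proof (cases "x = 0")
      case False
      have "(\<lambda>n. x / sqrt (x\<^sup>2 + e n)) \<longlonglongrightarrow> x / \<bar>x\<bar>"
        using False by (intro tendsto_divide tendsto_const lim) simp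
      then show ?thesis by (simp add: real_sgn_eq)
    qed simp
  qed (use lim \<open>a \<le> b\<close> in auto)
qed

text \<open>The antiderivatives \<open>arctan (n x) / n\<close> tend to 0 while their derivatives tend to the
  indicator of \<open>{0}\<close>; this avoids almost everywhere differentiability of \<open>w\<close>.\<close>

lemma density_zero_on_level_set:
  fixes v w :: "real \<Rightarrow> real"
  assumes v: "integrable lborel v" and w: "\<And>t. w t = c + (LBINT u:{..t}. v u)"
  shows "AE u in lborel. w u = 0 \<longrightarrow> v u = 0"
proof -
  have [measurable]: "v \<in> borel_measurable borel" using v by auto
  have "continuous_on UNIV w"
    using continuous_set_integral_Iic[OF v] by (simp add: continuous_at_imp_continuous_on w[abs_def])
  then have [measurable]: "w \<in> borel_measurable borel" by (rule borel_measurable_continuous_onI)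
  define h where "h u = indicator {0} (w u) * v u" for u
  have [measurable]: "h \<in> borel_measurable borel" unfolding h_def by measurable
  have h: "integrable lborel h"
    by (rule Bochner_Integration.integrable_bound[OF v]) (auto simp: h_def indicator_def)
  have Ioc: "(LBINT u:{a<..b}. h u) = 0" if "a \<le> b" for a b
  proof -
    have "0 - 0 = (LBINT u:{a<..b}. indicator {0} (w u) * v u)"
    proof (rule chain_rule_limit[where \<phi>="\<lambda>_. 0"
          and \<Phi>="\<lambda>n x. arctan (real (Suc n) * x) / real (Suc n)"
          and \<Phi>'="\<lambda>n x. 1 / (1 + (real (Suc n) * x)\<^sup>2)" and \<psi>="indicator {0}", OF v w])
      show "((\<lambda>x. arctan (real (Suc n) * x) / real (Suc n)) has_real_derivative
          1 / (1 + (real (Suc n) * x)\<^sup>2)) (at x)" for n x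
      proof -
        have "((\<lambda>x. arctan (k * x) / k) has_real_derivative 1 / (1 + (k * x)\<^sup>2)) (at x)"
          if "k \<noteq> 0" for k
          using that by (auto intro!: derivative_eq_intros simp: inverse_eq_divide)
        then show ?thesis by (metis of_nat_neq_0)
      qed
      have pos: "0 < 1 + (real (Suc n) * x)\<^sup>2" for n x by (intro add_pos_nonneg) auto
      show "continuous_on UNIV (\<lambda>x. 1 / (1 + (real (Suc n) * x)\<^sup>2))" for n
        using pos by (intro continuous_intros) (auto simp: less_imp_neq[symmetric])
      show "\<bar>1 / (1 + (real (Suc n) * x)\<^sup>2)\<bar> \<le> 1" for n x
        using pos[of n x] by (simp add: divide_le_eq)
      show "(\<lambda>n. arctan (real (Suc n) * x) / real (Suc n)) \<longlonglongrightarrow> 0" for x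
      proof (rule Lim_null_comparison)
        show "\<forall>\<^sub>F n in sequentially. norm (arctan (real (Suc n) * x) / real (Suc n)) \<le> pi * inverse (real (Suc n))"
        proof (rule always_eventually, rule allI)
          fix n
          have "\<bar>arctan (real (Suc n) * x)\<bar> \<le> pi"
            using arctan_bounded[of "real (Suc n) * x"] pi_gt_zero by (simp add: abs_le_iff)
          then show "norm (arctan (real (Suc n) * x) / real (Suc n)) \<le> pi * inverse (real (Suc n))"
            by (simp add: divide_inverse abs_mult)
        qed
        show "(\<lambda>n. pi * inverse (real (Suc n))) \<longlonglongrightarrow> 0"
          using tendsto_mult[OF tendsto_const LIMSEQ_inverse_real_of_nat] by simp
      qed
      show "(\<lambda>n. 1 / (1 + (real (Suc n) * x)\<^sup>2)) \<longlonglongrightarrow> indicator {0} x" for x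
      proof (cases "x = 0")
        case False
        then have "(\<lambda>n. 1 / (1 + (real (Suc n) * x)\<^sup>2)) \<longlonglongrightarrow> 0" by real_asymp
        with False show ?thesis by simp
      qed simp
    qed (rule that)
    then show ?thesis by (simp add: h_def)
  qed
  \<comment> \<open>The chain rule speaks of bounded intervals only, so the ray is exhausted by the
    intervals \<open>{- real n<..x}\<close>.\<close>
  have "(LBINT u:{..x}. h u) = 0" for x
  proof (rule LIMSEQ_unique)
    have "(\<lambda>n. LBINT u:{- real n<..x}. h u) \<longlonglongrightarrow> (LBINT u:(\<Union>n. {- real n<..x}). h u)"
      by (rule set_integral_cont_up)
         (auto intro!: set_integrable_if_integrable h simp: incseq_def)
    also have "(\<Union>n. {- real n<..x}) = {..x}"
      by auto (metis minus_minus neg_less_iff_less reals_Archimedean2)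
    finally show "(\<lambda>n. LBINT u:{- real n<..x}. h u) \<longlonglongrightarrow> (LBINT u:{..x}. h u)" .
    show "(\<lambda>n. LBINT u:{- real n<..x}. h u) \<longlonglongrightarrow> 0"
    proof (rule tendsto_eventually)
      obtain N where "- x \<le> real N" using real_arch_simple by blast
      then show "\<forall>\<^sub>F n in sequentially. (LBINT u:{- real n<..x}. h u) = 0"
        by (intro eventually_sequentiallyI[of N] Ioc) linarith
    qed
  qed
  from AE_zero_if_set_integral_Iic_zero[OF h this] show ?thesis
    by eventually_elim (auto simp: h_def)
qed

subsection \<open>Convolution on the line\<close>

text \<open>Integration runs over the whole line; for functions that vanish at negative times this
  is the usual convolution over \<open>{0..t}\<close>.\<close>

definition convol :: "(real \<Rightarrow> real) \<Rightarrow> (real \<Rightarrow> real) \<Rightarrow> real \<Rightarrow> real" where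
  "convol a g t = (LBINT u. a u * g (t - u))"

lemma convolution_commute: "convol a g = convol g a"
proof
  fix t
  have "(LBINT u. a u * g (t - u)) = (LBINT u. a (t - u) * g u)"
    by (subst lborel_integral_real_affine[where c="-1" and t=t]) auto
  then show "convol a g t = convol g a t" by (simp add: convol_def mult.commute)
qed

context
  fixes a g :: "real \<Rightarrow> real"
  assumes a: "integrable lborel a" and g: "integrable lborel g"
begin

text \<open>By translation invariance the inner integral of the absolute value is
  \<open>\<bar>a u\<bar>\<close> times the total mass of \<open>\<bar>g\<bar>\<close>, which is
  integrable in \<open>u\<close>.\<close>

lemma integrable_convolution_pair: "integrable (lborel \<Otimes>\<^sub>M lborel) (\<lambda>(u, s). a u * g (s - u))"
proof (rule lborel_pair.Fubini_integrable)
  have [measurable]: "a \<in> borel_measurable borel" "g \<in> borel_measurable borel" using a g by auto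
  show "(\<lambda>(u, s). a u * g (s - u)) \<in> borel_measurable (lborel \<Otimes>\<^sub>M lborel)" by measurable
  have gu: "integrable lborel (\<lambda>s. g (s - u))" for u
    using lborel_integrable_real_affine[OF g, of 1 "-u"] by simp
  then show "AE u in lborel. integrable lborel (\<lambda>s. case (u, s) of (u, s) \<Rightarrow> a u * g (s - u))"
    by simp
  have "(LBINT s. \<bar>g (s - u)\<bar>) = (LBINT s. \<bar>g s\<bar>)" for u
    using lborel_integral_real_affine[of 1 "\<lambda>s. \<bar>g s\<bar>" "-u"] by simp
  then have "(LBINT s. norm (a u * g (s - u))) = \<bar>a u\<bar> * (LBINT s. \<bar>g s\<bar>)" for u
    by (simp add: abs_mult)
  then show "integrable lborel (\<lambda>u. LBINT s. norm (case (u, s) of (u, s) \<Rightarrow> a u * g (s - u)))"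
    using a by simp
qed

lemma AE_integrable_convolution: "AE s in lborel. integrable lborel (\<lambda>u. a u * g (s - u))"
  using lborel_pair.AE_integrable_snd[OF integrable_convolution_pair] .

lemma integrable_convolution: "integrable lborel (convol a g)"
  using lborel_pair.integrable_snd[OF integrable_convolution_pair]
  by (simp add: convol_def[abs_def])

text \<open>Fubini and the shift \<open>s \<mapsto> s + u\<close>. Integrating a convolution in time
  replaces the density \<open>g\<close> by its distribution function.\<close>

lemma set_integral_Iic_convolution:
  "(LBINT s:{..t}. convol a g s) = (LBINT u. a u * (LBINT s:{..t - u}. g s))"
proof -
  have i: "integrable (lborel \<Otimes>\<^sub>M lborel) (\<lambda>(u, s). indicator {..t} s * (a u * g (s - u)))"
  proof -
    have "integrable (lborel \<Otimes>\<^sub>M lborel)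
        (\<lambda>z. indicator (UNIV \<times> {..t}) z *\<^sub>R (case z of (u, s) \<Rightarrow> a u * g (s - u)))"
      by (intro integrable_mult_indicator integrable_convolution_pair) simp
    then show ?thesis
      by (rule back_subst[of "integrable (lborel \<Otimes>\<^sub>M lborel)"])
         (auto simp: fun_eq_iff indicator_def)
  qed
  have "(LBINT s:{..t}. convol a g s) = (LBINT s. LBINT u. indicator {..t} s * (a u * g (s - u)))"
    by (simp add: set_lebesgue_integral_def convol_def)
  also have "\<dots> = (LBINT u. LBINT s. indicator {..t} s * (a u * g (s - u)))"
    using lborel_pair.Fubini_integral[OF i] .
  also have "\<dots> = (LBINT u. a u * (LBINT s:{..t - u}. g s))"
  proof (rule Bochner_Integration.integral_cong)
    fix u
    have "(LBINT s. indicator {..t} s * (a u * g (s - u))) = a u * (LBINT s. indicator {..t} s * g (s - u))"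
      by (simp add: mult.left_commute)
    also have "(LBINT s. indicator {..t} s * g (s - u)) = (LBINT s. indicator {..t - u} s * g s)"
      by (subst lborel_integral_real_affine[where c=1 and t=u])
         (auto intro!: Bochner_Integration.integral_cong simp: indicator_def)
    finally show "(LBINT s. indicator {..t} s * (a u * g (s - u))) = a u * (LBINT s:{..t - u}. g s)"
      by (simp add: set_lebesgue_integral_def)
  qed simp
  finally show ?thesis .
qed

end

text \<open>By commutativity the integral may fall on \<open>a\<close> instead. This form expresses
  cumulative departures through the cumulative function of \<open>a\<close>.\<close>

lemma set_integral_Iic_convolution':
  assumes "integrable lborel a" and "integrable lborel g"
  shows "(LBINT s:{..t}. convol a g s) = (LBINT u. (LBINT s:{..t - u}. a s) * g u)"
  unfolding convolution_commute[of a] set_integral_Iic_convolution[OF assms(2,1)]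
  by (simp add: mult.commute)

lemma abs_convolution_le:
  assumes "\<And>x. 0 \<le> g x"
  shows "\<bar>convol a g t\<bar> \<le> convol (\<lambda>u. \<bar>a u\<bar>) g t"
  using integral_abs_bound[of lborel "\<lambda>u. a u * g (t - u)"] assms
  by (simp add: convol_def abs_mult)

text \<open>Additivity holds where both convolution integrals exist, which is guaranteed for almost
  every \<open>s\<close> only.\<close>

lemma AE_convolution_diff:
  assumes "integrable lborel a" "integrable lborel b" "integrable lborel g"
  shows "AE s in lborel. convol (\<lambda>u. a u - b u) g s = convol a g s - convol b g s"
  using AE_integrable_convolution[OF assms(1,3)] AE_integrable_convolution[OF assms(2,3)]
  by eventually_elim (simp add: convol_def left_diff_distrib)

subsection \<open>Uniqueness\<close>

text \<open>All data are Borel functions on the whole line, extended by zero; \<open>l\<close> is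
  also cut off after \<open>T\<close>, which makes it integrable. Convolutions and integrals then
  need no bounds at 0.\<close>

locale loss_data =
  fixes T \<rho>0 :: real and l g f :: "real \<Rightarrow> real"
  assumes T_pos: "0 < T" and \<rho>0: "0 \<le> \<rho>0" "\<rho>0 \<le> 1"
    and integrable_l: "integrable lborel l" and l_nonneg: "\<And>u. 0 \<le> l u"
    and l_zero: "\<And>u. u \<notin> {0..T} \<Longrightarrow> l u = 0"
    and integrable_g: "integrable lborel g" and g_nonneg: "\<And>u. 0 \<le> g u"
    and g_zero: "\<And>u. u < 0 \<Longrightarrow> g u = 0" and g_le_1: "(LBINT u. g u) \<le> 1"
    and integrable_f: "integrable lborel f" and f_nonneg: "\<And>u. 0 \<le> f u"
    and f_zero: "\<And>u. u < 0 \<Longrightarrow> f u = 0" and f_le_1: "(LBINT u. f u) \<le> 1"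
begin

lemma l_neg: "u < 0 \<Longrightarrow> l u = 0" by (simp add: l_zero)

definition drift :: "(real \<Rightarrow> real) \<Rightarrow> real \<Rightarrow> real" where
  "drift a u = a u - \<rho>0 * f u - convol a g u"

text \<open>The problem with \<open>z\<close> eliminated: \<open>a\<close> stands for
  \<open>z * lam\<close>, so that \<open>0 \<le> z \<le> 1\<close> turns into
  \<open>0 \<le> a \<le> l\<close>. The Volterra equation appears in differentiated form, and full
  admission is demanded only below level 1.\<close>

definition solution :: "(real \<Rightarrow> real) \<Rightarrow> (real \<Rightarrow> real) \<Rightarrow> bool" where
  "solution a \<rho> \<longleftrightarrow> a \<in> borel_measurable borel \<and> (\<forall>u. 0 \<le> a u \<and> a u \<le> l u) \<and>
     (\<forall>t\<in>{0..T}. \<rho> t = \<rho>0 + (LBINT u:{..t}. drift a u)) \<and> (\<forall>t\<in>{0..T}. \<rho> t \<le> 1) \<and>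
     (AE u in lborel. u \<in> {0..T} \<longrightarrow> \<rho> u < 1 \<longrightarrow> a u = l u)"

lemma integrable_dominated:
  assumes "a \<in> borel_measurable borel" and "\<And>u. 0 \<le> a u \<and> a u \<le> l u"
  shows "integrable lborel a"
proof (rule Bochner_Integration.integrable_bound[OF integrable_l])
  show "AE u in lborel. norm (a u) \<le> norm (l u)" using assms(2) l_nonneg by auto
qed (use assms in simp)

lemma integrable_drift: "integrable lborel a \<Longrightarrow> integrable lborel (drift a)"
  unfolding drift_def[abs_def]
  by (intro Bochner_Integration.integrable_diff integrable_mult_right integrable_f
      integrable_convolution integrable_g)

lemma convolution_zero:
  assumes "\<And>u. u < 0 \<Longrightarrow> a u = 0" and "t < 0"
  shows "convol a g t = 0"
proof -
  have "a u * g (t - u) = 0" for u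
    using assms g_zero[of "t - u"] by (cases "u < 0") auto
  then have "(\<lambda>u. a u * g (t - u)) = (\<lambda>_. 0)" by blast
  then show ?thesis by (simp add: convol_def)
qed

lemma drift_zero: "(\<And>u. u < 0 \<Longrightarrow> a u = 0) \<Longrightarrow> u < 0 \<Longrightarrow> drift a u = 0"
  by (simp add: drift_def convolution_zero f_zero)

text \<open>The function \<open>\<rho> - 1\<close> is an indefinite integral of
  \<open>drift a\<close>, so this density vanishes almost everywhere where \<open>\<rho>\<close>
  equals 1.\<close>

lemma solution_saturated:
  assumes "solution a \<rho>"
  shows "AE u in lborel. u \<in> {0..T} \<longrightarrow> \<rho> u = 1 \<longrightarrow> a u = \<rho>0 * f u + convol a g u"
proof -
  have "integrable lborel (drift a)"
    using assms by (intro integrable_drift integrable_dominated) (auto simp: solution_def)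
  from density_zero_on_level_set[OF this, of "\<lambda>t. (\<rho>0 - 1) + (LBINT u:{..t}. drift a u)", OF refl]
  show ?thesis
  proof eventually_elim
    case (elim u)
    then show ?case using assms by (auto simp: solution_def drift_def)
  qed
qed

section \<open>The service distribution function and the integrated drift\<close>

definition service_cdf :: "real \<Rightarrow> real" where
  "service_cdf x = (LBINT u:{..x}. g u)"

lemma service_cdf_nonneg: "0 \<le> service_cdf x"
  unfolding service_cdf_def set_lebesgue_integral_def
  by (intro integral_nonneg_AE) (auto simp: g_nonneg)

lemma service_cdf_le_1: "service_cdf x \<le> 1"
  unfolding service_cdf_def
  by (rule order_trans[OF set_integral_Iic_le[OF integrable_g g_nonneg] g_le_1])

lemma service_cdf_neg: "x \<le> 0 \<Longrightarrow> service_cdf x = 0"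
  unfolding service_cdf_def by (rule set_integral_Iic_nonpos[OF g_zero])

lemma isCont_service_cdf: "isCont service_cdf x"
  using continuous_set_integral_Iic[OF integrable_g] by (simp add: service_cdf_def[abs_def])

lemma borel_measurable_service_cdf [measurable]: "service_cdf \<in> borel_measurable borel"
  using isCont_service_cdf
  by (intro borel_measurable_continuous_onI continuous_at_imp_continuous_on) auto

lemma integrable_mult_service_cdf:
  assumes "integrable lborel a"
  shows "integrable lborel (\<lambda>u. a u * service_cdf (t - u))"
proof (rule Bochner_Integration.integrable_bound[OF assms])
  show "AE u in lborel. norm (a u * service_cdf (t - u)) \<le> norm (a u)"
    using service_cdf_nonneg service_cdf_le_1 by (auto simp: abs_mult intro!: mult_left_le)
qed (use assms in measurable)

text \<open>This kernel is the survival function \<open>1 - service_cdf (t - u)\<close> for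
  \<open>u \<le> t\<close> and zero afterwards.\<close>

lemma residual_nonneg: "0 \<le> indicator {..t} u - service_cdf (t - u)"
  using service_cdf_le_1[of "t - u"] service_cdf_neg[of "t - u"] by (auto simp: indicator_def)

lemma integrable_residual:
  assumes "integrable lborel a"
  shows "integrable lborel (\<lambda>u. a u * (indicator {..t} u - service_cdf (t - u)))"
proof -
  have "integrable lborel (\<lambda>u. a u * indicator {..t} u)"
    using set_integrable_if_integrable[OF assms, of "{..t}"]
    by (simp add: set_integrable_def mult.commute)
  then show ?thesis
    unfolding right_diff_distrib
    by (intro Bochner_Integration.integrable_diff integrable_mult_service_cdf assms)
qed

lemma set_integral_minus_convolution:
  assumes a: "integrable lborel a"
  shows "(LBINT u:{..t}. a u - convol a g u) = (LBINT u. a u * (indicator {..t} u - service_cdf (t - u)))"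
proof -
  have i: "integrable lborel (\<lambda>u. a u * indicator {..t} u)"
    using set_integrable_if_integrable[OF a, of "{..t}"]
    by (simp add: set_integrable_def mult.commute)
  have "(LBINT u:{..t}. a u - convol a g u) = (LBINT u:{..t}. a u) - (LBINT u:{..t}. convol a g u)"
    using a integrable_convolution[OF a integrable_g]
    by (intro set_integral_diff(2)) (auto intro: set_integrable_if_integrable)
  also have "(LBINT u:{..t}. convol a g u) = (LBINT u. a u * service_cdf (t - u))"
    unfolding service_cdf_def by (rule set_integral_Iic_convolution[OF a integrable_g])
  also have "(LBINT u:{..t}. a u) = (LBINT u. a u * indicator {..t} u)"
    by (simp add: set_lebesgue_integral_def mult.commute)
  also have "\<dots> - (LBINT u. a u * service_cdf (t - u))
      = (LBINT u. a u * indicator {..t} u - a u * service_cdf (t - u))"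
    by (rule Bochner_Integration.integral_diff[symmetric, OF i integrable_mult_service_cdf[OF a]])
  finally show ?thesis by (simp add: right_diff_distrib)
qed

text \<open>Links the differentiated form to the Volterra form: integrating \<open>a\<close> minus
  its convolution with \<open>g\<close> weights each admission at \<open>u\<close> with the
  probability of still being in service at \<open>t\<close>.\<close>

lemma set_integral_drift:
  assumes a: "integrable lborel a"
  shows "\<rho>0 + (LBINT u:{..t}. drift a u)
    = \<rho>0 * (1 - (LBINT u:{..t}. f u)) + (LBINT u. a u * (indicator {..t} u - service_cdf (t - u)))"
proof -
  have "(LBINT u:{..t}. drift a u) = (LBINT u:{..t}. (a u - convol a g u) - \<rho>0 * f u)"
    by (simp add: drift_def algebra_simps)
  also have "\<dots> = (LBINT u:{..t}. a u - convol a g u) - (LBINT u:{..t}. \<rho>0 * f u)"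
    using a integrable_convolution[OF a integrable_g] integrable_f
    by (intro set_integral_diff(2)) (auto intro!: set_integrable_if_integrable)
  finally show ?thesis by (simp add: set_integral_minus_convolution[OF a] algebra_simps)
qed

text \<open>With \<open>w = \<rho> - \<rho>'\<close>, \<open>d = a - a'\<close> and \<open>v = w' = d - d * g\<close>, the sign of \<open>d\<close> is opposite to that
  of \<open>w\<close>, and \<open>v = 0\<close> almost everywhere on \<open>{w = 0}\<close>. Hence \<open>sgn w \<cdot> v \<le> - \<bar>d\<bar> + \<bar>d\<bar> * g\<close>, whose
  integral is nonpositive.\<close>

lemma solution_unique:
  assumes sol: "solution a \<rho>" and sol': "solution a' \<rho>'"
  shows "\<forall>t\<in>{0..T}. \<rho>' t = \<rho> t" and "AE u in lborel. a' u = a u"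
proof -
  have a: "integrable lborel a" and a': "integrable lborel a'"
    using sol sol' by (auto simp: solution_def intro!: integrable_dominated)
  have [measurable]: "a \<in> borel_measurable borel" "a' \<in> borel_measurable borel"
    using a a' by auto
  have al: "0 \<le> a u" "a u \<le> l u" "0 \<le> a' u" "a' u \<le> l u" for u
    using sol sol' by (auto simp: solution_def)
  have a_zero: "a u = 0" "a' u = 0" if "u < 0" for u
    using al[of u] l_zero[of u] that by auto
  define d where "d u = a u - a' u" for u
  define D where "D = (\<lambda>u. \<bar>d u\<bar>)"
  define v where "v u = drift a u - drift a' u" for u
  define w where "w t = 0 + (LBINT u:{..t}. v u)" for t
  have d: "integrable lborel d" unfolding d_def[abs_def] using a a' by simp
  then have D: "integrable lborel D" unfolding D_def by simp
  have [measurable]: "D \<in> borel_measurable borel" using D by auto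
  have D0: "0 \<le> D u" for u by (simp add: D_def)
  have D_zero: "D u = 0" if "u < 0" for u using a_zero that by (simp add: D_def d_def)
  have v: "integrable lborel v"
    unfolding v_def[abs_def] using a a' by (intro Bochner_Integration.integrable_diff integrable_drift)
  have v_zero: "v u = 0" if "u < 0" for u
    using drift_zero[of a] drift_zero[of a'] a_zero that by (simp add: v_def)
  have w_eq: "w t = \<rho> t - \<rho>' t" if "t \<in> {0..T}" for t
  proof -
    have "(LBINT u:{..t}. v u) = (LBINT u:{..t}. drift a u) - (LBINT u:{..t}. drift a' u)"
      unfolding v_def using a a'
      by (intro set_integral_diff(2) set_integrable_if_integrable integrable_drift) auto
    then show ?thesis using sol sol' that by (auto simp: w_def solution_def)
  qed
  have w_neg: "w t = 0" if "t < 0" for t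
  proof -
    have "(LBINT u:{..t}. v u) = (LBINT u:{..t}. 0)"
      using that v_zero by (intro set_lebesgue_integral_cong) auto
    then show ?thesis by (simp add: w_def)
  qed
  have conv_D: "integrable lborel (convol D g)"
    using D integrable_g by (rule integrable_convolution)
  have conv_D_nonneg: "0 \<le> convol D g t" for t
    unfolding convol_def by (intro integral_nonneg_AE) (auto simp: D_def g_nonneg)
  have key: "AE u in lborel. u \<in> {..T} \<longrightarrow> sgn (w u) * v u \<le> - D u + convol D g u"
    using density_zero_on_level_set[OF v w_def] AE_convolution_diff[OF a a' integrable_g]
      sol[unfolded solution_def, THEN conjunct2, THEN conjunct2, THEN conjunct2, THEN conjunct2]
      sol'[unfolded solution_def, THEN conjunct2, THEN conjunct2, THEN conjunct2, THEN conjunct2]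
  proof eventually_elim
    case (elim u)
    show ?case
    proof
      assume "u \<in> {..T}"
      have vu: "v u = d u - convol d g u"
        using elim(2) by (simp add: v_def drift_def d_def[abs_def])
      have conv: "\<bar>convol d g u\<bar> \<le> convol D g u"
        using abs_convolution_le[of g d u] g_nonneg by (simp add: D_def)
      show "sgn (w u) * v u \<le> - D u + convol D g u"
      proof (cases "u < 0")
        case True
        then show ?thesis using v_zero D_zero conv_D_nonneg by simp
      next
        case False
        then have u: "u \<in> {0..T}" using \<open>u \<in> {..T}\<close> by simp
        then have le1: "\<rho> u \<le> 1" "\<rho>' u \<le> 1" using sol sol' by (auto simp: solution_def)
        \<comment> \<open>If \<open>w u < 0\<close>, then
          \<open>\<rho> u < \<rho>' u \<le> 1\<close>, so \<open>a u = l u \<ge> a' u\<close>; the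
          case \<open>0 < w u\<close> is symmetric. If \<open>w u = 0\<close>, then
          \<open>v u = 0\<close>, and \<open>d u\<close> equals its own convolution.\<close>
        consider "w u = 0" | "w u < 0" | "0 < w u" by linarith
        then show ?thesis
        proof cases
          case 1
          then have "d u = convol d g u" using elim(1) vu by simp
          then show ?thesis using conv 1 by (simp add: D_def)
        next
          case 2
          then have "a u = l u" using w_eq[OF u] le1 elim(3) u by simp
          then have "D u = d u" using al by (simp add: D_def d_def)
          then show ?thesis using vu conv 2 by simp
        next
          case 3
          then have "a' u = l u" using w_eq[OF u] le1 elim(4) u by simp
          then have "D u = - d u" using al by (simp add: D_def d_def)
          then show ?thesis using vu conv 3 by simp
        qed
      qed
    qed
  qed
  have bound: "\<bar>w t\<bar> \<le> - (LBINT u. D u * (indicator {..t} u - service_cdf (t - u)))"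
    if t: "t \<in> {0..T}" for t
  proof -
    \<comment> \<open>Any negative starting time serves, as \<open>w\<close> and all integrands
      vanish there.\<close>
    have "\<bar>w t\<bar> = \<bar>w t\<bar> - \<bar>w (-1)\<bar>" by (simp add: w_neg)
    also have "\<dots> = (LBINT u:{-1<..t}. sgn (w u) * v u)"
      using t by (intro abs_set_integral_Iic[OF v w_def]) auto
    also have "\<dots> \<le> (LBINT u:{-1<..t}. - D u + convol D g u)"
      unfolding set_lebesgue_integral_def
    proof (rule integral_mono_AE)
      have "continuous_on UNIV w"
        using continuous_set_integral_Iic[OF v]
        by (simp add: continuous_at_imp_continuous_on w_def[abs_def])
      then have [measurable]: "w \<in> borel_measurable borel" by (rule borel_measurable_continuous_onI)
      have [measurable]: "v \<in> borel_measurable borel" using v by auto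
      show "integrable lborel (\<lambda>u. indicat_real {-1<..t} u *\<^sub>R (sgn (w u) * v u))"
        by (rule Bochner_Integration.integrable_bound[OF v])
           (auto simp: indicator_def sgn_real_def)
      show "integrable lborel (\<lambda>u. indicat_real {-1<..t} u *\<^sub>R (- D u + convol D g u))"
        using D conv_D by (intro integrable_mult_indicator) auto
      show "AE u in lborel. indicat_real {-1<..t} u *\<^sub>R (sgn (w u) * v u)
          \<le> indicat_real {-1<..t} u *\<^sub>R (- D u + convol D g u)"
        using key by eventually_elim (use t in \<open>auto simp: indicator_def\<close>)
    qed
    also have "\<dots> = (LBINT u:{..t}. - D u + convol D g u)"
      unfolding set_lebesgue_integral_def
    proof (rule Bochner_Integration.integral_cong)
      fix u
      have "convol D g u = 0" if "u < 0"
        using convolution_zero[of D] D_zero that by blast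
      then show "indicat_real {-1<..t} u *\<^sub>R (- D u + convol D g u)
          = indicat_real {..t} u *\<^sub>R (- D u + convol D g u)"
        using D_zero[of u] by (cases "u < 0") (auto simp: indicator_def)
    qed simp
    also have "\<dots> = - (LBINT u:{..t}. D u - convol D g u)"
      unfolding set_lebesgue_integral_def integral_minus[symmetric]
      by (intro Bochner_Integration.integral_cong) (auto simp: algebra_simps)
    also have "(LBINT u:{..t}. D u - convol D g u) = (LBINT u. D u * (indicator {..t} u - service_cdf (t - u)))"
      by (rule set_integral_minus_convolution[OF D])
    finally show ?thesis .
  qed
  have nonneg: "0 \<le> D u * (indicator {..t} u - service_cdf (t - u))" for t u
    using residual_nonneg D0 by simp
  note int = integrable_residual[OF D]
  \<comment> \<open>By \<open>bound\<close>, the nonnegative \<open>\<bar>w t\<bar>\<close> is at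
    most minus a nonnegative integral, so both are zero.\<close>
  have int_zero: "w t = 0 \<and> (LBINT u. D u * (indicator {..t} u - service_cdf (t - u))) = 0"
    if "t \<in> {0..T}" for t
  proof -
    have "0 \<le> (LBINT u. D u * (indicator {..t} u - service_cdf (t - u)))"
      by (intro integral_nonneg_AE) (simp add: nonneg)
    then show ?thesis using bound[OF that] by (intro conjI; linarith)
  qed
  then show "\<forall>t\<in>{0..T}. \<rho>' t = \<rho> t" using w_eq by force
  have AE_t: "AE u in lborel. D u * (indicator {..t} u - service_cdf (t - u)) = 0"
    if "t \<in> {0..T}" for t
    using int_zero[OF that] integral_nonneg_eq_0_iff_AE[OF int[where t=t]] nonneg by auto
  \<comment> \<open>As \<open>service_cdf\<close> is continuous and zero at 0, the survival kernel
    at \<open>t\<close> is positive on the window from \<open>t - h\<close> to \<open>t\<close>;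
    there the vanishing integral forces \<open>D = 0\<close>.\<close>
  obtain h where h: "0 < h" "\<And>x. \<bar>x\<bar> \<le> h \<Longrightarrow> service_cdf x < 1"
  proof -
    have "service_cdf 0 < 1" by (simp add: service_cdf_neg)
    then have "\<forall>\<^sub>F x in at 0. service_cdf x < 1"
      using isCont_service_cdf[of 0] by (intro order_tendstoD(2)) (auto simp: isCont_def)
    then obtain e where "0 < e" "\<And>x. x \<noteq> 0 \<Longrightarrow> \<bar>x\<bar> < e \<Longrightarrow> service_cdf x < 1"
      by (auto simp: eventually_at dist_real_def)
    then show ?thesis
      using that[of "e/2"] \<open>service_cdf 0 < 1\<close> by (metis abs_zero field_sum_of_halves half_gt_zero less_add_same_cancel1 order_le_less_trans)
  qed
  \<comment> \<open>The exceptional null set depends on the time, so only the countably many grid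
    times \<open>k * h\<close>, capped at \<open>T\<close>, are used; their windows cover
    \<open>{0..T}\<close>.\<close>
  have "AE u in lborel. \<forall>k::nat. D u * (indicator {..min T (real k * h)} u - service_cdf (min T (real k * h) - u)) = 0"
    unfolding AE_all_countable using T_pos h(1) by (intro allI AE_t) auto
  then show "AE u in lborel. a' u = a u"
  proof eventually_elim
    case (elim u)
    show ?case
    proof (cases "u \<in> {0..T}")
      case True
      \<comment> \<open>The first grid time strictly after \<open>u\<close>; it exceeds
        \<open>u\<close> by at most \<open>h\<close>.\<close>
      define k where "k = Suc (nat \<lfloor>u / h\<rfloor>)"
      have "real k * h \<le> u + h" "u < real k * h"
      proof -
        have "real (nat \<lfloor>u / h\<rfloor>) = real_of_int \<lfloor>u / h\<rfloor>" using True h by simp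
        then have "real k = real_of_int \<lfloor>u / h\<rfloor> + 1" by (simp add: k_def)
        then have "real k - 1 \<le> u / h" "u / h < real k" by linarith+
        then show "real k * h \<le> u + h" "u < real k * h" using h(1) by (simp_all add: field_simps)
      qed
      then have "u \<le> min T (real k * h)" "service_cdf (min T (real k * h) - u) < 1"
        using True by (auto intro!: h(2))
      then have "D u = 0" using elim[rule_format, of k] by simp
      then show ?thesis by (simp add: D_def d_def)
    next
      case False
      then show ?thesis using al[of u] l_zero[of u] by simp
    qed
  qed
qed

subsection \<open>Existence\<close>

definition arrivals :: "real \<Rightarrow> real" where
  "arrivals t = (LBINT u:{..t}. l u)"

text \<open>Candidates for the cumulative admissions, the integral of some \<open>a\<close> with
  \<open>0 \<le> a \<le> l\<close>. Phrasing this through increments makes the class closed under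
  pointwise suprema.\<close>

definition admissible :: "(real \<Rightarrow> real) set" where
  "admissible = {A. (\<forall>t\<le>0. A t = 0) \<and>
     (\<forall>s t. s \<le> t \<longrightarrow> A s \<le> A t \<and> A t - A s \<le> arrivals t - arrivals s)}"

text \<open>The free path of the reflection problem: every arrival enters, while departures after
  admission are computed from the given \<open>A\<close>.\<close>

definition unconstrained :: "(real \<Rightarrow> real) \<Rightarrow> real \<Rightarrow> real" where
  "unconstrained A t =
     \<rho>0 * (1 - (LBINT u:{..t}. f u)) + arrivals t - (LBINT u. A (t - u) * g u)"

text \<open>All data vanish at negative times, so the running supremum may start at
  \<open>-\<infinity>\<close>; its terms are zero for \<open>s \<le> 0\<close>.\<close>

definition losses :: "(real \<Rightarrow> real) \<Rightarrow> real \<Rightarrow> real" where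
  "losses A t = (SUP s\<in>{..t}. max 0 (unconstrained A s - 1))"

definition admitted :: "(real \<Rightarrow> real) \<Rightarrow> real \<Rightarrow> real" where
  "admitted A t = arrivals t - losses A t"

lemma arrivals_nonpos: "t \<le> 0 \<Longrightarrow> arrivals t = 0"
  unfolding arrivals_def by (rule set_integral_Iic_nonpos) (simp add: l_neg)

lemma arrivals_mono: "s \<le> t \<Longrightarrow> arrivals s \<le> arrivals t"
  unfolding arrivals_def by (rule set_integral_Iic_mono[OF integrable_l l_nonneg])

lemma arrivals_le: "arrivals t \<le> (LBINT u. l u)"
  unfolding arrivals_def by (rule set_integral_Iic_le[OF integrable_l l_nonneg])

section \<open>The reflection map at a single admissible function\<close>

context
  fixes A :: "real \<Rightarrow> real"
  assumes A: "A \<in> admissible"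
begin

lemma admissible_nonpos: "t \<le> 0 \<Longrightarrow> A t = 0"
  using A by (simp add: admissible_def)

lemma admissible_mono: "s \<le> t \<Longrightarrow> A s \<le> A t"
  using A by (simp add: admissible_def)

lemma admissible_increment: "s \<le> t \<Longrightarrow> A t - A s \<le> arrivals t - arrivals s"
  using A by (simp add: admissible_def)

lemma admissible_nonneg: "0 \<le> A t"
  using admissible_mono[of 0 t] admissible_nonpos[of t] admissible_nonpos[of 0] by (cases "t \<le> 0") auto

lemma admissible_le_arrivals: "A t \<le> arrivals t"
  using admissible_increment[of "min t 0" t] admissible_nonpos[of "min t 0"] arrivals_nonpos[of "min t 0"]
  by simp

lemma borel_measurable_admissible: "A \<in> borel_measurable borel"
  by (rule borel_measurable_mono) (simp add: mono_def admissible_mono)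

lemma integrable_departures: "integrable lborel (\<lambda>u. A (t - u) * g u)"
proof (rule Bochner_Integration.integrable_bound)
  note [measurable] = borel_measurable_admissible borel_measurable_integrable[OF integrable_g]
  show "integrable lborel (\<lambda>u. (LBINT u. l u) * g u)" using integrable_g by simp
  show "(\<lambda>u. A (t - u) * g u) \<in> borel_measurable lborel" by measurable
  have "A s \<le> (LBINT u. l u)" for s using admissible_le_arrivals[of s] arrivals_le[of s] by simp
  then show "AE u in lborel. norm (A (t - u) * g u) \<le> norm ((LBINT u. l u) * g u)"
    using admissible_nonneg g_nonneg
    by (auto simp: abs_mult intro!: mult_right_mono order_trans[OF _ abs_ge_self])
qed

lemma departures_mono:
  assumes "s \<le> t"
  shows "(LBINT u. A (s - u) * g u) \<le> (LBINT u. A (t - u) * g u)"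
  using assms by (intro integral_mono integrable_departures mult_right_mono admissible_mono g_nonneg) auto

lemma departures_nonneg: "0 \<le> (LBINT u. A (t - u) * g u)"
  by (intro integral_nonneg_AE) (simp add: admissible_nonneg g_nonneg)

lemma unconstrained_le: "unconstrained A t \<le> 1 + arrivals t"
proof -
  have "0 \<le> (LBINT u:{..t}. f u)"
    unfolding set_lebesgue_integral_def by (intro integral_nonneg_AE) (simp add: f_nonneg)
  then have "\<rho>0 * (1 - (LBINT u:{..t}. f u)) \<le> \<rho>0 * 1" using \<rho>0 by (intro mult_left_mono) auto
  then show ?thesis using departures_nonneg[of t] \<rho>0 by (simp add: unconstrained_def)
qed

lemma unconstrained_increment:
  assumes "s \<le> t"
  shows "unconstrained A t - unconstrained A s \<le> arrivals t - arrivals s"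
proof -
  have "\<rho>0 * (1 - (LBINT u:{..t}. f u)) \<le> \<rho>0 * (1 - (LBINT u:{..s}. f u))"
    using set_integral_Iic_mono[OF integrable_f f_nonneg assms] \<rho>0 by (intro mult_left_mono) auto
  then show ?thesis using departures_mono[OF assms] by (simp add: unconstrained_def)
qed

lemma losses_bdd: "bdd_above ((\<lambda>s. max 0 (unconstrained A s - 1)) ` {..t})"
proof (rule bdd_aboveI2)
  fix s assume "s \<in> {..t}"
  then show "max 0 (unconstrained A s - 1) \<le> arrivals t"
    using unconstrained_le[of s] arrivals_mono[of s t] arrivals_mono[of "min s 0" s] arrivals_nonpos[of "min s 0"]
    by auto
qed

lemma le_losses: "s \<le> t \<Longrightarrow> max 0 (unconstrained A s - 1) \<le> losses A t"
  unfolding losses_def by (rule cSUP_upper[OF _ losses_bdd]) simp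

lemma losses_least: "(\<And>s. s \<le> t \<Longrightarrow> max 0 (unconstrained A s - 1) \<le> c) \<Longrightarrow> losses A t \<le> c"
  unfolding losses_def by (rule cSUP_least) auto

lemma losses_nonneg: "0 \<le> losses A t"
  using le_losses[of t t] by simp

lemma losses_mono: "s \<le> t \<Longrightarrow> losses A s \<le> losses A t"
  by (rule losses_least) (rule le_losses, simp)

text \<open>A value of \<open>unconstrained A\<close> at a time after \<open>s\<close> exceeds the
  value at \<open>s\<close> by at most the arrivals in between, and \<open>losses A s\<close>
  already accounts for the value at \<open>s\<close>.\<close>

lemma losses_increment:
  assumes "s \<le> t"
  shows "losses A t - losses A s \<le> arrivals t - arrivals s"
proof -
  have "losses A t \<le> losses A s + (arrivals t - arrivals s)"
  proof (rule losses_least)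
    fix r assume "r \<le> t"
    show "max 0 (unconstrained A r - 1) \<le> losses A s + (arrivals t - arrivals s)"
    proof (cases "r \<le> s")
      case True
      then show ?thesis using le_losses[OF True] arrivals_mono[OF assms] by simp
    next
      case False
      then show ?thesis
        using unconstrained_increment[of s r] le_losses[of s s] arrivals_mono[OF \<open>r \<le> t\<close>]
          arrivals_mono[OF assms] losses_nonneg[of s] by auto
    qed
  qed
  then show ?thesis by simp
qed

lemma losses_nonpos:
  assumes "t \<le> 0"
  shows "losses A t = 0"
proof (rule antisym)
  show "losses A t \<le> 0"
  proof (rule losses_least)
    fix s assume "s \<le> t"
    then show "max 0 (unconstrained A s - 1) \<le> 0"
      using unconstrained_le[of s] arrivals_nonpos[of s] assms by simp
  qed
qed (rule losses_nonneg)

lemma admitted_admissible: "admitted A \<in> admissible"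
  using losses_increment losses_mono
  by (force simp: admissible_def admitted_def arrivals_nonpos losses_nonpos)

end

text \<open>More admissions cause more departures, hence a lower free path and fewer losses.\<close>

lemma admitted_mono:
  assumes "A \<in> admissible" "B \<in> admissible" "\<And>t. A t \<le> B t"
  shows "admitted A t \<le> admitted B t"
proof -
  have "(LBINT u. A (s - u) * g u) \<le> (LBINT u. B (s - u) * g u)" for s
    using assms by (intro integral_mono integrable_departures mult_right_mono g_nonneg) auto
  then have le: "unconstrained B s \<le> unconstrained A s" for s by (simp add: unconstrained_def)
  have "losses B t \<le> losses A t"
  proof (rule losses_least[OF assms(2)])
    fix s assume "s \<le> t"
    show "max 0 (unconstrained B s - 1) \<le> losses A t"
      using le_losses[OF assms(1) \<open>s \<le> t\<close>] le[of s] by simp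
  qed
  then show ?thesis by (simp add: admitted_def)
qed

text \<open>Knaster--Tarski: the admissible functions are closed under pointwise suprema.\<close>

lemma admissible_fixpoint: "\<exists>A\<in>admissible. admitted A = A"
proof -
  \<comment> \<open>The post-fixed points, which include the zero function; their pointwise supremum
    is the fixed point.\<close>
  define S where "S = {B \<in> admissible. \<forall>t. B t \<le> admitted B t}"
  define A where "A t = (SUP B\<in>S. B t)" for t
  have zero_adm: "(\<lambda>_. 0) \<in> admissible" using arrivals_mono by (simp add: admissible_def)
  have zero_S: "(\<lambda>_. 0) \<in> S"
    using zero_adm admissible_nonneg[OF admitted_admissible[OF zero_adm]] by (simp add: S_def)
  then have ne: "S \<noteq> {}" by auto
  have bdd: "bdd_above ((\<lambda>B. B t) ` S)" for t
    using admissible_le_arrivals by (intro bdd_aboveI2[of _ _ "arrivals t"]) (auto simp: S_def)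
  have upper: "B t \<le> A t" if "B \<in> S" for B t
    unfolding A_def using that by (rule cSUP_upper[OF _ bdd])
  have least: "A t \<le> c" if "\<And>B. B \<in> S \<Longrightarrow> B t \<le> c" for t c
    unfolding A_def using ne that by (rule cSUP_least)
  have A: "A \<in> admissible"
    unfolding admissible_def
  proof (intro CollectI conjI allI impI)
    fix t :: real assume "t \<le> 0"
    have "A t \<le> 0"
    proof (rule least)
      fix B assume "B \<in> S"
      then show "B t \<le> 0" using admissible_nonpos[of B t] \<open>t \<le> 0\<close> by (simp add: S_def)
    qed
    then show "A t = 0" using upper[OF zero_S, of t] by simp
  next
    fix s t :: real assume st: "s \<le> t"
    show "A s \<le> A t"
    proof (rule least)
      fix B assume B: "B \<in> S"
      then have "B s \<le> B t" using admissible_mono[of B, OF _ st] by (simp add: S_def)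
      then show "B s \<le> A t" using upper[OF B, of t] by simp
    qed
    have "A t \<le> A s + (arrivals t - arrivals s)"
    proof (rule least)
      fix B assume B: "B \<in> S"
      then show "B t \<le> A s + (arrivals t - arrivals s)"
        using admissible_increment[of B, OF _ st] upper[OF B, of s] by (simp add: S_def)
    qed
    then show "A t - A s \<le> arrivals t - arrivals s" by simp
  qed
  have le: "A t \<le> admitted A t" for t
  proof (rule least)
    fix B assume B: "B \<in> S"
    then have "B t \<le> admitted B t" by (simp add: S_def)
    also have "\<dots> \<le> admitted A t" using B upper[OF B] A by (intro admitted_mono) (auto simp: S_def)
    finally show "B t \<le> admitted A t" .
  qed
  \<comment> \<open>By monotonicity the image of a post-fixed point is again one, so it lies below
    the supremum \<open>A\<close>.\<close>
  have "admitted A \<in> S"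
    using admitted_admissible[OF A] le A by (auto simp: S_def intro!: admitted_mono)
  then have "admitted A = A" using upper le by (intro ext antisym) auto
  with A show ?thesis by blast
qed

text \<open>For the density \<open>a\<close> of the fixed point, \<open>\<rho>\<close> is the free
  path minus the losses, which keeps it below 1. Losses are constant around any time with
  \<open>\<rho> < 1\<close>, and since \<open>l - a\<close> is their density, \<open>a = l\<close>
  almost everywhere at such times.\<close>

lemma solution_exists: "\<exists>a \<rho>. solution a \<rho>"
proof -
  obtain A where A: "A \<in> admissible" and fix_A: "admitted A = A" using admissible_fixpoint by blast
  obtain a where a_meas: "a \<in> borel_measurable borel" and al: "\<And>u. 0 \<le> a u \<and> a u \<le> l u"
    and Aa: "\<And>t. A t = (LBINT u:{..t}. a u)"
    using density_of_dominated_increments[OF integrable_l l_nonneg l_neg admissible_mono[OF A]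
        admissible_increment[OF A, unfolded arrivals_def] admissible_nonpos[OF A]] by blast
  have a: "integrable lborel a" using a_meas al by (rule integrable_dominated)
  define \<rho> where "\<rho> t = \<rho>0 + (LBINT u:{..t}. drift a u)" for t
  have losses_eq: "losses A t = arrivals t - A t" for t
    using fix_A by (simp add: admitted_def fun_eq_iff algebra_simps)
  have \<rho>_eq: "\<rho> t = unconstrained A t - losses A t" for t
  proof -
    have "(LBINT u:{..t}. drift a u) = (LBINT u:{..t}. a u - \<rho>0 * f u) - (LBINT u:{..t}. convol a g u)"
      unfolding drift_def using a integrable_f integrable_convolution[OF a integrable_g]
      by (intro set_integral_diff(2)) (auto intro!: set_integrable_if_integrable)
    also have "(LBINT u:{..t}. a u - \<rho>0 * f u) = (LBINT u:{..t}. a u) - (LBINT u:{..t}. \<rho>0 * f u)"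
      using a integrable_f by (intro set_integral_diff(2)) (auto intro!: set_integrable_if_integrable)
    also have "(LBINT u:{..t}. convol a g u) = (LBINT u. A (t - u) * g u)"
      unfolding Aa by (rule set_integral_Iic_convolution'[OF a integrable_g])
    finally show ?thesis
      by (simp add: \<rho>_def unconstrained_def losses_eq Aa[symmetric] algebra_simps)
  qed
  have \<rho>_le: "\<rho> t \<le> 1" for t
    using le_losses[OF A order_refl, of t] by (simp add: \<rho>_eq)
  have cont_losses: "isCont (losses A) t" for t
    unfolding losses_eq[abs_def] arrivals_def Aa
    by (intro continuous_diff continuous_set_integral_Iic integrable_l a)
  have cont_\<rho>: "isCont \<rho> t" for t
    unfolding \<rho>_def[abs_def]
    by (intro continuous_add continuous_const continuous_set_integral_Iic integrable_drift a)
  have cont_X: "isCont (unconstrained A) t" for t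
  proof -
    have "unconstrained A = (\<lambda>t. \<rho> t + losses A t)" by (simp add: \<rho>_eq fun_eq_iff)
    then show ?thesis using cont_\<rho>[of t] cont_losses[of t] by (simp add: continuous_add)
  qed
  have flat: "\<exists>p\<in>\<rat>. \<exists>q\<in>\<rat>. p < t \<and> t < q \<and> losses A p = losses A q" if "\<rho> t < 1" for t
  proof -
    have "unconstrained A t - 1 < losses A t" using that by (simp add: \<rho>_eq)
    \<comment> \<open>By continuity \<open>c\<close> separates the free path minus 1 from the losses
      on a neighbourhood of \<open>t\<close>. No value taken there can raise the running supremum,
      so it is the same at \<open>p\<close> and at \<open>q\<close>.\<close>
    then obtain c where c: "unconstrained A t - 1 < c" "c < losses A t" using dense by blast
    have "\<forall>\<^sub>F s in nhds t. unconstrained A s - 1 < c \<and> c < losses A s"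
    proof (rule eventually_conj)
      have "((\<lambda>s. unconstrained A s - 1) \<longlongrightarrow> unconstrained A t - 1) (nhds t)"
        using cont_X[of t] by (intro tendsto_diff tendsto_const) (simp add: continuous_at tendsto_nhds_iff)
      then show "\<forall>\<^sub>F s in nhds t. unconstrained A s - 1 < c" using c(1) by (rule order_tendstoD)
      have "(losses A \<longlongrightarrow> losses A t) (nhds t)"
        using cont_losses[of t] by (simp add: continuous_at tendsto_nhds_iff)
      then show "\<forall>\<^sub>F s in nhds t. c < losses A s" using c(2) by (rule order_tendstoD)
    qed
    then obtain e where "0 < e" and e: "\<And>s. dist s t < e \<Longrightarrow> unconstrained A s - 1 < c \<and> c < losses A s"
      by (auto simp: eventually_nhds_metric)
    obtain p where p: "p \<in> \<rat>" "t - e < p" "p < t" using Rats_dense_in_real[of "t - e" t] \<open>0 < e\<close> by auto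
    obtain q where q: "q \<in> \<rat>" "t < q" "q < t + e" using Rats_dense_in_real[of t "t + e"] \<open>0 < e\<close> by auto
    have "losses A q \<le> losses A p"
    proof (rule losses_least[OF A])
      fix s assume "s \<le> q"
      show "max 0 (unconstrained A s - 1) \<le> losses A p"
      proof (cases "s \<le> p")
        case True
        then show ?thesis by (rule le_losses[OF A])
      next
        case False
        then have "unconstrained A s - 1 < c" using e[of s] p q \<open>s \<le> q\<close> by (auto simp: dist_real_def)
        moreover have "c < losses A p" using e[of p] p by (auto simp: dist_real_def)
        ultimately show ?thesis using losses_nonneg[OF A, of p] by simp
      qed
    qed
    moreover have "losses A p \<le> losses A q" using p q by (intro losses_mono[OF A]) simp
    ultimately show ?thesis using p q by (intro bexI[of _ p] bexI[of _ q]) auto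
  qed
  \<comment> \<open>Rational endpoints leave countably many intervals, whose null sets can be
    united.\<close>
  have "AE u in lborel. \<forall>p\<in>\<rat>. \<forall>q\<in>\<rat>. p \<le> q \<longrightarrow> losses A p = losses A q \<longrightarrow> u \<in> {p<..q} \<longrightarrow> a u = l u"
  proof (intro AE_ball_countable' countable_rat)
    fix p q :: real
    show "AE u in lborel. p \<le> q \<longrightarrow> losses A p = losses A q \<longrightarrow> u \<in> {p<..q} \<longrightarrow> a u = l u"
    proof (cases "p \<le> q \<and> losses A p = losses A q")
      case True
      have la: "integrable lborel (\<lambda>u. l u - a u)" using a integrable_l by simp
      have "(LBINT u:{..t}. l u - a u) = losses A t" for t
        unfolding losses_eq arrivals_def Aa using a integrable_l
        by (intro set_integral_diff(2)) (auto intro!: set_integrable_if_integrable)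
      then have "(LBINT u:{p<..q}. l u - a u) = 0"
        using set_integral_Iic_diff[OF la, of p q] True by simp
      moreover have i: "integrable lborel (\<lambda>u. indicat_real {p<..q} u *\<^sub>R (l u - a u))"
        by (rule integrable_mult_indicator[OF _ la]) simp
      ultimately have "AE u in lborel. indicat_real {p<..q} u *\<^sub>R (l u - a u) = 0"
        using integral_nonneg_eq_0_iff_AE[OF i] al by (simp add: set_lebesgue_integral_def)
      then show ?thesis by eventually_elim (auto simp: indicator_def)
    qed auto
  qed
  then have "AE u in lborel. u \<in> {0..T} \<longrightarrow> \<rho> u < 1 \<longrightarrow> a u = l u"
  proof eventually_elim
    case (elim u)
    then show ?case using flat[of u] by (force intro: less_imp_le order.strict_trans)
  qed
  then have "solution a \<rho>"
    unfolding solution_def using a_meas al \<rho>_le by (auto simp: \<rho>_def)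
  then show ?thesis by blast
qed

end

subsection \<open>Lebesgue measurable data\<close>

text \<open>Lebesgue measure is complete: a preimage under \<open>\<phi>\<close> differs from the
  one under \<open>\<psi>\<close> only within a null set, all of whose subsets are
  measurable.\<close>

lemma borel_measurable_lebesgue_if_AE_eq:
  fixes \<phi> \<psi> :: "real \<Rightarrow> real"
  assumes [measurable]: "\<psi> \<in> borel_measurable borel" and eq: "AE u in lborel. \<phi> u = \<psi> u"
  shows "\<phi> \<in> borel_measurable lebesgue"
proof (rule measurableI)
  fix X :: "real set" assume [measurable]: "X \<in> sets borel"
  have [measurable]: "\<psi> \<in> borel_measurable lebesgue" by (rule measurable_completion) simp
  have [measurable]: "Measurable.pred lebesgue (\<lambda>u. \<phi> u \<in> X \<and> \<phi> u \<noteq> \<psi> u)"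
    "Measurable.pred lebesgue (\<lambda>u. \<phi> u \<noteq> \<psi> u)"
    using eq by (intro sets_completion_AE; eventually_elim; simp)+
  have "Measurable.pred lebesgue (\<lambda>u. (\<phi> u \<in> X \<and> \<phi> u \<noteq> \<psi> u) \<or> (\<psi> u \<in> X \<and> \<not> \<phi> u \<noteq> \<psi> u))"
    by measurable
  also have "(\<lambda>u. (\<phi> u \<in> X \<and> \<phi> u \<noteq> \<psi> u) \<or> (\<psi> u \<in> X \<and> \<not> \<phi> u \<noteq> \<psi> u)) = (\<lambda>u. \<phi> u \<in> X)"
    by auto
  finally show "\<phi> -` X \<inter> space lebesgue \<in> sets lebesgue"
    by (simp add: pred_def vimage_def)
qed simp

lemma integral_lebesgue_eq_lborel:
  fixes \<phi> \<psi> :: "real \<Rightarrow> real"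
  assumes \<psi>: "\<psi> \<in> borel_measurable borel" and eq: "AE u in lborel. \<phi> u = \<psi> u"
  shows "(LINT u|lebesgue. \<phi> u) = (LBINT u. \<psi> u)"
proof -
  have "(LINT u|lebesgue. \<phi> u) = (LINT u|lebesgue. \<psi> u)"
    using eq \<psi>
    by (intro integral_cong_AE borel_measurable_lebesgue_if_AE_eq[OF \<psi>])
       (auto simp: AE_completion_iff measurable_completion)
  also have "\<dots> = (LBINT u. \<psi> u)" using \<psi> by (intro integral_completion) simp
  finally show ?thesis .
qed

text \<open>As \<open>P\<close> need not be measurable, the transformation is applied to a Borel
  null set that contains all its exceptions.\<close>

lemma AE_lborel_affine:
  fixes P :: "real \<Rightarrow> bool"
  assumes "AE x in lborel. P x" and "c \<noteq> 0"
  shows "AE x in lborel. P (t + c * x)"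
proof -
  obtain N where N: "{x. \<not> P x} \<subseteq> N" "N \<in> null_sets lborel"
    using assms(1) by (auto elim!: AE_E simp: null_sets_def)
  then have [measurable]: "N \<in> sets borel" by (auto dest: null_setsD2)
  have "AE x in lborel. x \<notin> N" using N(2) by (rule AE_not_in)
  then have "AE x in lborel. t + c * x \<notin> N"
    by (intro AE_borel_affine[OF assms(2)]) auto
  then show ?thesis by eventually_elim (use N in auto)
qed

lemma AE_lebesgue_on_iff:
  "S \<in> sets borel \<Longrightarrow> (AE u in lebesgue_on S. P u) \<longleftrightarrow> (AE u in lborel. u \<in> S \<longrightarrow> P u)"
  by (subst AE_restrict_space_iff) (auto simp: AE_completion_iff)

lemma borel_version:
  fixes h :: "real \<Rightarrow> real"
  assumes h: "set_integrable lebesgue S h" and S: "S \<in> sets borel" and nonneg: "\<And>u. u \<in> S \<Longrightarrow> 0 \<le> h u"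
  obtains q where "integrable lborel q" "\<And>u. 0 \<le> q u" "\<And>u. u \<notin> S \<Longrightarrow> q u = 0"
    "AE u in lborel. u \<in> S \<longrightarrow> h u = q u"
proof -
  have hi: "integrable lebesgue (\<lambda>u. indicator S u *\<^sub>R h u)" using h by (simp add: set_integrable_def)
  obtain q0 where [measurable]: "q0 \<in> borel_measurable borel"
    and q0: "AE u in lborel. indicator S u *\<^sub>R h u = q0 u"
    using completion_ex_borel_measurable_real[OF borel_measurable_integrable[OF hi]] by auto
  \<comment> \<open>The maximum and the indicator make the sign and the support correct at every
    point, not just almost everywhere.\<close>
  define q where "q u = indicator S u * max 0 (q0 u)" for u
  have [measurable]: "q \<in> borel_measurable borel" unfolding q_def using S by measurable
  have eq: "AE u in lborel. indicator S u *\<^sub>R h u = q u"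
    using q0
  proof eventually_elim
    case (elim u)
    then show ?case using nonneg[of u] by (cases "u \<in> S") (simp_all add: q_def)
  qed
  have "integrable lebesgue q"
  proof (rule integrable_cong_AE_imp[OF hi])
    show "q \<in> borel_measurable lebesgue" by (rule measurable_completion) simp
    show "AE u in lebesgue. indicator S u *\<^sub>R h u = q u"
      unfolding AE_completion_iff by (rule eq)
  qed
  then have "integrable lborel q" by (simp add: integrable_completion)
  moreover have "AE u in lborel. u \<in> S \<longrightarrow> h u = q u"
    using eq by eventually_elim auto
  ultimately show thesis by (intro that[of q]) (auto simp: q_def)
qed

lemma density_on_halfline:
  assumes G: "distribution_function_halfline G" and g: "has_density_halfline G g"
  obtains q where "integrable lborel q" "\<And>u. 0 \<le> q u" "\<And>u. u < 0 \<Longrightarrow> q u = 0" "(LBINT u. q u) \<le> 1"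
    "AE u in lborel. 0 \<le> u \<longrightarrow> g u = q u" "\<And>t. 0 \<le> t \<Longrightarrow> G t = (LBINT u:{..t}. q u)"
proof -
  obtain q where q: "integrable lborel q" "\<And>u. 0 \<le> q u" "\<And>u. u \<notin> {0..} \<Longrightarrow> q u = 0"
    and eq: "AE u in lborel. u \<in> {0..} \<longrightarrow> g u = q u"
    using borel_version[of "{0..}" g] g by (auto simp: has_density_halfline_def)
  have G_eq: "G t = (LBINT u:{..t}. q u)" if "0 \<le> t" for t
  proof -
    have "G t = (LINT u|lebesgue. indicator {0..t} u *\<^sub>R g u)"
      using g that by (simp add: has_density_halfline_def set_lebesgue_integral_def)
    also have "\<dots> = (LBINT u. indicator {..t} u *\<^sub>R q u)"
    proof (rule integral_lebesgue_eq_lborel)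
      have [measurable]: "q \<in> borel_measurable borel" using q(1) by auto
      show "(\<lambda>u. indicat_real {..t} u *\<^sub>R q u) \<in> borel_measurable borel" by measurable
      show "AE u in lborel. indicat_real {0..t} u *\<^sub>R g u = indicat_real {..t} u *\<^sub>R q u"
        using eq by eventually_elim (use q(3) in \<open>auto simp: indicator_def\<close>)
    qed
    finally show ?thesis by (simp add: set_lebesgue_integral_def)
  qed
  have "(LBINT u. q u) \<le> 1"
  \<comment> \<open>The total mass is the limit of \<open>G (real n)\<close>, and values of a
    distribution function are at most 1.\<close>
  proof (rule LIMSEQ_le_const2)
    have "(\<lambda>n. LBINT u:{..real n}. q u) \<longlonglongrightarrow> (LBINT u:(\<Union>n. {..real n}). q u)"
      by (rule set_integral_cont_up) (auto intro!: set_integrable_if_integrable q simp: incseq_def)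
    also have "(\<Union>n. {..real n}) = UNIV" using real_arch_simple by auto
    finally show "(\<lambda>n. LBINT u:{..real n}. q u) \<longlonglongrightarrow> (LBINT u. q u)"
      by (simp add: set_lebesgue_integral_def)
    have "G (real n) \<le> 1" for n
    proof -
      obtain M where "real_distribution M" "\<forall>t\<ge>0. G t = cdf M t"
        using G by (auto simp: distribution_function_halfline_def)
      then show ?thesis using real_distribution.cdf_bounded_prob by simp
    qed
    then show "\<exists>N. \<forall>n\<ge>N. (LBINT u:{..real n}. q u) \<le> 1" using G_eq by auto
  qed
  with q eq G_eq show thesis by (intro that[of q]) auto
qed

text \<open>\<open>l\<close>, \<open>g\<close>, \<open>f\<close> are Borel versions, extended by zero, of the Lebesgue measurable data
  \<open>lam\<close>, \<open>g'\<close>, \<open>f'\<close>.\<close>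

locale loss_versions = loss_data T \<rho>0 l g f
  for T \<rho>0 :: real and l g f :: "real \<Rightarrow> real" +
  fixes lam G g' F f' :: "real \<Rightarrow> real"
  assumes lam: "AE u in lborel. u \<in> {0..T} \<longrightarrow> lam u = l u"
    and G: "\<And>t. 0 \<le> t \<Longrightarrow> G t = (LBINT u:{..t}. g u)" and g': "AE u in lborel. 0 \<le> u \<longrightarrow> g' u = g u"
    and F: "\<And>t. 0 \<le> t \<Longrightarrow> F t = (LBINT u:{..t}. f u)" and f': "AE u in lborel. 0 \<le> u \<longrightarrow> f' u = f u"
begin

section \<open>The Volterra integrals in terms of the Borel versions\<close>

context
  fixes a z :: "real \<Rightarrow> real"
  assumes a_meas: "a \<in> borel_measurable borel" and al: "\<And>u. 0 \<le> a u \<and> a u \<le> l u"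
    and za: "AE u in lborel. u \<in> {0..T} \<longrightarrow> z u * lam u = a u"
begin

lemma volterra_integral_eq:
  assumes t: "t \<in> {0..T}"
  shows "\<rho>0 * (1 - F t) + (LINT u:{0..t}|lebesgue. z u * (1 - G (t - u)) * lam u)
    = \<rho>0 + (LBINT u:{..t}. drift a u)"
proof -
  note [measurable] = a_meas
  have "(LINT u:{0..t}|lebesgue. z u * (1 - G (t - u)) * lam u)
      = (LBINT u. a u * (indicator {..t} u - service_cdf (t - u)))"
    unfolding set_lebesgue_integral_def
  proof (rule integral_lebesgue_eq_lborel)
    show "(\<lambda>u. a u * (indicator {..t} u - service_cdf (t - u))) \<in> borel_measurable borel" by measurable
    show "AE u in lborel. indicat_real {0..t} u *\<^sub>R (z u * (1 - G (t - u)) * lam u)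
        = a u * (indicator {..t} u - service_cdf (t - u))"
      using za
    proof eventually_elim
      case (elim u)
      consider "u < 0" | "u \<in> {0..t}" | "t < u" by fastforce
      then show ?case
      proof cases
        case 1
        then show ?thesis using al[of u] l_neg[of u] by simp
      next
        case 2
        then have "z u * lam u = a u" "G (t - u) = service_cdf (t - u)"
          using elim t G by (auto simp: service_cdf_def)
        then show ?thesis using 2 by (simp add: mult.commute mult.left_commute)
      next
        case 3
        then show ?thesis by (simp add: service_cdf_neg)
      qed
    qed
  qed
  then show ?thesis
    using set_integral_drift[OF integrable_dominated[OF a_meas al], of t] F[of t] t by simp
qed

lemma convolution_eq:
  assumes t: "t \<in> {0..T}"
  shows "(LINT u:{0..t}|lebesgue. z u * lam u * g' (t - u)) = convol a g t"
  unfolding set_lebesgue_integral_def convol_def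
proof (rule integral_lebesgue_eq_lborel)
  note [measurable] = a_meas borel_measurable_integrable[OF integrable_g]
  show "(\<lambda>u. a u * g (t - u)) \<in> borel_measurable borel" by measurable
  \<comment> \<open>The densities agree almost everywhere only; the reflection
    \<open>u \<mapsto> t - u\<close> preserves null sets.\<close>
  have "AE u in lborel. 0 \<le> t + (-1) * u \<longrightarrow> g' (t + (-1) * u) = g (t + (-1) * u)"
    by (rule AE_lborel_affine[OF g']) simp
  then show "AE u in lborel. indicat_real {0..t} u *\<^sub>R (z u * lam u * g' (t - u)) = a u * g (t - u)"
    using za
  proof eventually_elim
    case (elim u)
    consider "u < 0" | "u \<in> {0..t}" | "t < u" by fastforce
    then show ?case
    proof cases
      case 1
      then show ?thesis using al[of u] l_neg[of u] by simp
    next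
      case 2
      then show ?thesis using elim t by auto
    next
      case 3
      then show ?thesis by (simp add: g_zero)
    qed
  qed
qed

end

section \<open>Translation between Volterra solutions, the pair system and
  \<open>solution\<close>\<close>

lemma solution_if_volterra_solution:
  assumes "volterra_solution T lam G \<rho>0 F \<rho> z"
  obtains a where "solution a \<rho>" and "AE u in lborel. u \<in> {0..T} \<longrightarrow> z u * lam u = a u"
proof -
  have z_meas: "z \<in> borel_measurable (lebesgue_on {0..T})"
    and \<rho>: "\<And>t. t \<in> {0..T} \<Longrightarrow>
      \<rho> t = \<rho>0 * (1 - F t) + (LINT u:{0..t}|lebesgue. z u * (1 - G (t - u)) * lam u)"
    and \<rho>_le: "\<And>t. t \<in> {0..T} \<Longrightarrow> \<rho> t \<le> 1"
    and z: "AE t in lborel. t \<in> {0..T} \<longrightarrow> indicator {s. \<rho> s < 1} t \<le> z t \<and> z t \<le> 1"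
    using assms by (auto simp: volterra_solution_def AE_lebesgue_on_iff)
  have "(\<lambda>u. indicator {0..T} u *\<^sub>R z u) \<in> borel_measurable lebesgue"
    using z_meas by (subst (asm) borel_measurable_restrict_space_iff) auto
  then obtain \<zeta> where [measurable]: "\<zeta> \<in> borel_measurable borel"
    and \<zeta>: "AE u in lborel. indicator {0..T} u *\<^sub>R z u = \<zeta> u"
    using completion_ex_borel_measurable_real by fastforce
  \<comment> \<open>Clipping to the range from 0 to \<open>l u\<close> enforces the bounds at every
    point; almost everywhere on \<open>{0..T}\<close> it changes nothing, as
    \<open>0 \<le> z \<le> 1\<close> there.\<close>
  define a where "a u = max 0 (min (\<zeta> u * l u) (l u))" for u
  have [measurable]: "l \<in> borel_measurable borel" using integrable_l by auto
  have a_meas: "a \<in> borel_measurable borel" unfolding a_def by measurable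
  have al: "0 \<le> a u \<and> a u \<le> l u" for u using l_nonneg[of u] by (auto simp: a_def)
  have za: "AE u in lborel. u \<in> {0..T} \<longrightarrow> z u * lam u = a u"
    using z \<zeta> lam
  proof eventually_elim
    case (elim u)
    show ?case
    proof
      assume u: "u \<in> {0..T}"
      have "(0::real) \<le> indicator {s. \<rho> s < 1} u" by simp
      moreover have "indicator {s. \<rho> s < 1} u \<le> z u" "z u \<le> 1" "\<zeta> u = z u" "lam u = l u"
        using elim u by auto
      ultimately have "0 \<le> z u" "z u \<le> 1" "\<zeta> u = z u" "lam u = l u" by linarith+
      then show "z u * lam u = a u"
        using l_nonneg[of u] mult_right_le_one_le[of "l u" "z u"] by (simp add: a_def mult.commute)
    qed
  qed
  have "AE u in lborel. u \<in> {0..T} \<longrightarrow> \<rho> u < 1 \<longrightarrow> a u = l u"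
    using z za lam by eventually_elim (auto simp: indicator_def split: if_splits)
  then have "solution a \<rho>"
    unfolding solution_def using a_meas al \<rho>_le \<rho> volterra_integral_eq[OF a_meas al za] by auto
  then show thesis using za by (rule that)
qed

lemma volterra_solution_if_solution:
  assumes sol: "solution a \<rho>"
  shows "\<exists>z. volterra_solution T lam G \<rho>0 F \<rho> z"
proof -
  have a_meas: "a \<in> borel_measurable borel" and al: "\<And>u. 0 \<le> a u \<and> a u \<le> l u"
    and \<rho>: "\<And>t. t \<in> {0..T} \<Longrightarrow> \<rho> t = \<rho>0 + (LBINT u:{..t}. drift a u)"
    and \<rho>_le: "\<And>t. t \<in> {0..T} \<Longrightarrow> \<rho> t \<le> 1"
    and sat: "AE u in lborel. u \<in> {0..T} \<longrightarrow> \<rho> u < 1 \<longrightarrow> a u = l u"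
    using sol by (auto simp: solution_def)
  \<comment> \<open>The value 1 where \<open>l\<close> vanishes ensures \<open>z u = 1\<close>
    whenever \<open>a u = l u\<close>, as the lower bound on \<open>z\<close> requires where
    \<open>\<rho> < 1\<close>.\<close>
  define z where "z u = (if l u = 0 then 1 else a u / l u)" for u
  have [measurable]: "l \<in> borel_measurable borel" "a \<in> borel_measurable borel"
    using integrable_l a_meas by auto
  have z_meas: "z \<in> borel_measurable borel" unfolding z_def by measurable
  have zl: "z u * l u = a u" for u using al[of u] by (auto simp: z_def)
  have z01: "0 \<le> z u" "z u \<le> 1" for u
    using al[of u] l_nonneg[of u] by (auto simp: z_def divide_le_eq)
  have z_sat: "z u = 1" if "a u = l u" for u using that by (simp add: z_def)
  have za: "AE u in lborel. u \<in> {0..T} \<longrightarrow> z u * lam u = a u"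
    using lam by eventually_elim (simp add: zl)
  \<comment> \<open>In the Volterra form both summands are nonnegative: the mass of \<open>f\<close>
    is at most 1, and the survival kernel is nonnegative.\<close>
  have "0 \<le> \<rho> t" if t: "t \<in> {0..T}" for t
  proof -
    have "(LBINT u:{..t}. f u) \<le> 1"
      using set_integral_Iic_le[OF integrable_f f_nonneg, of t] f_le_1 by simp
    moreover have "0 \<le> (LBINT u. a u * (indicator {..t} u - service_cdf (t - u)))"
      using al residual_nonneg by (intro integral_nonneg_AE) simp
    ultimately show ?thesis
      unfolding \<rho>[OF t] set_integral_drift[OF integrable_dominated[OF a_meas al]]
      using \<rho>0 by simp
  qed
  moreover have "z \<in> borel_measurable (lebesgue_on {0..T})"
    using z_meas by (intro measurable_restrict_space1 measurable_completion) simp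
  moreover have "AE t in lebesgue_on {0..T}. indicator {s. \<rho> s < 1} t \<le> z t \<and> z t \<le> 1"
    unfolding AE_lebesgue_on_iff[OF borel_closed[OF closed_atLeastAtMost]]
    using sat by eventually_elim (use z01 z_sat in \<open>auto simp: indicator_def\<close>)
  ultimately have "volterra_solution T lam G \<rho>0 F \<rho> z"
    unfolding volterra_solution_def using \<rho> \<rho>_le volterra_integral_eq[OF a_meas al za]
    by simp
  then show ?thesis by blast
qed

text \<open>The clause for \<open>z * lam\<close> is automatic for a Volterra solution: below level
  1 it is full admission, and at level 1 it says that the drift vanishes, which is
  \<open>solution_saturated\<close>.\<close>

lemma volterra_pair_system_iff_solution:
  "volterra_pair_system T lam G g' \<rho>0 F f' \<rho> z \<longleftrightarrow> volterra_solution T lam G \<rho>0 F \<rho> z"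
proof (rule iffI)
  have integrand: "(\<lambda>u. z u * lam u * (1 - G (t - u))) = (\<lambda>u. z u * (1 - G (t - u)) * lam u)" for t
    by (simp add: mult.assoc mult.commute[of "lam _"])
  {
    assume "volterra_pair_system T lam G g' \<rho>0 F f' \<rho> z"
    then show "volterra_solution T lam G \<rho>0 F \<rho> z"
      unfolding volterra_pair_system_def volterra_solution_def integrand by blast
  }
  assume vs: "volterra_solution T lam G \<rho>0 F \<rho> z"
  then obtain a where sol: "solution a \<rho>" and za: "AE u in lborel. u \<in> {0..T} \<longrightarrow> z u * lam u = a u"
    by (rule solution_if_volterra_solution)
  have a_meas: "a \<in> borel_measurable borel" and al: "\<And>u. 0 \<le> a u \<and> a u \<le> l u"
    and \<rho>_le: "\<And>t. t \<in> {0..T} \<Longrightarrow> \<rho> t \<le> 1"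
    and sat: "AE u in lborel. u \<in> {0..T} \<longrightarrow> \<rho> u < 1 \<longrightarrow> a u = l u"
    using sol by (auto simp: solution_def)
  have "AE t in lborel. t \<in> {0..T} \<longrightarrow> z t * lam t =
      (if \<rho> t < 1 then lam t
       else \<rho>0 * f' t + (LINT u:{0..t}|lebesgue. z u * lam u * g' (t - u)))"
    using za sat solution_saturated[OF sol] lam f'
  proof eventually_elim
    case (elim t)
    show ?case
    proof
      assume t: "t \<in> {0..T}"
      show "z t * lam t = (if \<rho> t < 1 then lam t
          else \<rho>0 * f' t + (LINT u:{0..t}|lebesgue. z u * lam u * g' (t - u)))"
      proof (cases "\<rho> t < 1")
        case True
        then show ?thesis using elim t by simp
      next
        case False
        then have "\<rho> t = 1" using \<rho>_le[OF t] by simp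
        then show ?thesis using elim t by (simp add: convolution_eq[OF a_meas al za t])
      qed
    qed
  qed
  then have "AE t in lebesgue_on {0..T}. z t * lam t =
      (if \<rho> t < 1 then lam t
       else \<rho>0 * f' t + (LINT u:{0..t}|lebesgue. z u * lam u * g' (t - u)))"
    by (simp add: AE_lebesgue_on_iff)
  then show "volterra_pair_system T lam G g' \<rho>0 F f' \<rho> z"
    using vs unfolding volterra_pair_system_def volterra_solution_def integrand by blast
qed

end

theorem theorem3p2:
  fixes T \<rho>0 :: real and lam G g F f :: "real \<Rightarrow> real"
  assumes "0 < T"
    and "\<forall>t\<ge>0. 0 \<le> lam t" and "loc_integrable_halfline lam"
    and "distribution_function_halfline G" and "has_density_halfline G g"
    and "0 \<le> \<rho>0" and "\<rho>0 \<le> 1"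
    and "distribution_function_halfline F" and "has_density_halfline F f"
  shows "(\<exists>\<rho> z. volterra_pair_system T lam G g \<rho>0 F f \<rho> z) \<and>
    (\<forall>\<rho> z. volterra_pair_system T lam G g \<rho>0 F f \<rho> z \<longrightarrow>
       volterra_solution T lam G \<rho>0 F \<rho> z \<and>
       (\<forall>\<rho>' z'. volterra_solution T lam G \<rho>0 F \<rho>' z' \<longrightarrow>
          (\<forall>t\<in>{0..T}. \<rho>' t = \<rho> t) \<and>
          (AE t in lebesgue_on {0..T}. z' t * lam t = z t * lam t)))"
proof -
  obtain l where l: "integrable lborel l" "\<And>u. 0 \<le> l u" "\<And>u. u \<notin> {0..T} \<Longrightarrow> l u = 0"
    "AE u in lborel. u \<in> {0..T} \<longrightarrow> lam u = l u"
    using borel_version[of "{0..T}" lam] assms(1-3) by (auto simp: loc_integrable_halfline_def)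
  obtain gb where gb: "integrable lborel gb" "\<And>u. 0 \<le> gb u" "\<And>u. u < 0 \<Longrightarrow> gb u = 0"
    "(LBINT u. gb u) \<le> 1" "AE u in lborel. 0 \<le> u \<longrightarrow> g u = gb u"
    "\<And>t. 0 \<le> t \<Longrightarrow> G t = (LBINT u:{..t}. gb u)"
    using density_on_halfline[OF assms(4,5)] by blast
  obtain fb where fb: "integrable lborel fb" "\<And>u. 0 \<le> fb u" "\<And>u. u < 0 \<Longrightarrow> fb u = 0"
    "(LBINT u. fb u) \<le> 1" "AE u in lborel. 0 \<le> u \<longrightarrow> f u = fb u"
    "\<And>t. 0 \<le> t \<Longrightarrow> F t = (LBINT u:{..t}. fb u)"
    using density_on_halfline[OF assms(8,9)] by blast
  interpret loss_versions T \<rho>0 l gb fb lam G g F f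
    by unfold_locales (use assms l gb fb in auto)
  have "\<exists>\<rho> z. volterra_pair_system T lam G g \<rho>0 F f \<rho> z"
    using solution_exists volterra_solution_if_solution by (metis volterra_pair_system_iff_solution)
  \<comment> \<open>Any two Volterra solutions are compared; by the equivalence this covers every
    solution of the pair system.\<close>
  moreover have "(\<forall>t\<in>{0..T}. \<rho>' t = \<rho> t) \<and> (AE t in lebesgue_on {0..T}. z' t * lam t = z t * lam t)"
    if sol: "volterra_solution T lam G \<rho>0 F \<rho> z" and sol': "volterra_solution T lam G \<rho>0 F \<rho>' z'" for \<rho> z \<rho>' z'
  proof -
    obtain a where a: "solution a \<rho>" "AE u in lborel. u \<in> {0..T} \<longrightarrow> z u * lam u = a u"
      using sol by (rule solution_if_volterra_solution)
    obtain a' where a': "solution a' \<rho>'" "AE u in lborel. u \<in> {0..T} \<longrightarrow> z' u * lam u = a' u"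
      using sol' by (rule solution_if_volterra_solution)
    have "AE t in lborel. t \<in> {0..T} \<longrightarrow> z' t * lam t = z t * lam t"
      using a(2) a'(2) solution_unique(2)[OF a(1) a'(1)] by eventually_elim auto
    then show ?thesis using solution_unique(1)[OF a(1) a'(1)] by (simp add: AE_lebesgue_on_iff)
  qed
  ultimately show ?thesis by (simp add: volterra_pair_system_iff_solution)
qed

end
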